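(* Let $(S,d)$ be a stable metric space. The following are equivalent: (i) $S$ is stable compact; (ii) for every stable sequence $(R_n)_{n\in L^0_s(\mathbb N)}$ of stable closed subsets of $S$ which is decreasing ($R_m\subset R_n$ whenever $n\le m$), one has $\bigcap_nR_n\neq\emptyset$; (iii) $S$ is stable sequentially compact; (iv) $S$ is stable totally bounded and stable complete.
   Context: $L^0$: real measurable functions on a probability space $(\Omega,\mathcal F,\mathbb P)$ modulo a.e. equality, a.e. order; $L^0_+=\{r\ge0\}$, $L^0_{++}=\{r>0\text{ a.e.}\}$. An $L^0$-module $E$ is stable if for every countable measurable partition $(A_k)$ and $(x_k)\subset E$ there is a unique $x=\sum_k1_{A_k}x_k$ with $1_{A_k}x=1_{A_k}x_k$. A nonempty subset is stable if closed under concatenations; for stable sets $Y_k$, $\sum_k1_{A_k}Y_k=\{\sum_k1_{A_k}y_k:y_k\in Y_k\}$, and $\mathrm{st}(X)$ is the set of all concatenations of elements of $X$. A subset $N$ of a stable set $S$ is stable finite if $N=\sum_k1_{A_k}\mathrm{st}(X_k)$ for some countable partition $(A_k)$ and finite nonempty $X_k\subset S$. $L^0_s(\mathbb N)$ is the set of $n=\sum_k1_{A_k}n_k$, $n_k\in\mathbb N$ (concatenation pointwise, a.e. order). A map $f$ between stable sets is stable if $f(\sum_k1_{A_k}x_k)=\sum_k1_{A_k}f(x_k)$. A stable metric on a stable subset $S$ of a stable $L^0$-module is a stable map $d:S\times S\to L^0_+$ with $d(x,y)=0\iff x=y$, symmetry and the triangle inequality; the topology has base $B_r(x)=\{y:d(x,y)<r\}$,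 $x\in S$, $r\in L^0_{++}$. A stable sequence is a family $(x_n)_{n\in L^0_s(\mathbb N)}$ with $n\mapsto x_n$ stable (analogously for a stable sequence of stable sets: $R_{\sum1_{A_k}n_k}=\sum_k1_{A_k}R_{n_k}$). It converges to $x$ if for every $r\in L^0_{++}$ there is $n_0\in L^0_s(\mathbb N)$ with $d(x_n,x)<r$ for all $n\ge n_0$; it is Cauchy if for every $r\in L^0_{++}$ there is $n_0$ with $d(x_n,x_m)\le r$ for $n,m\ge n_0$. A stable subsequence is $(x_{n_k})_{k\in L^0_s(\mathbb N)}$ with $k\mapsto n_k$ stable and increasing. $S$ is stable complete if every Cauchy stable sequence converges; stable sequentially compact if every stable sequence has a stable subsequence converging in $S$; stable totally bounded if for every $r\in L^0_{++}$ there is a stable finite $N\subset S$ with $S=\bigcup_{x\in N}B_r(x)$. A filter on $S$ is stable if it has a filter base which is a stable collection of stable sets; $S$ is stable compact if every stable filter has a cluster point in $S$. *)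

theory Defs
  imports "HOL-Probability.Probability"
begin

section \<open>L0 (represented by measurable functions, compared almost everywhere)\<close>

definition L0 :: "'w measure \<Rightarrow> ('w \<Rightarrow> real) set" where
  "L0 M = borel_measurable M"

definition L0_eq :: "'w measure \<Rightarrow> ('w \<Rightarrow> real) \<Rightarrow> ('w \<Rightarrow> real) \<Rightarrow> bool" where
  "L0_eq M f g \<longleftrightarrow> (AE \<omega> in M. f \<omega> = g \<omega>)"

definition L0_le :: "'w measure \<Rightarrow> ('w \<Rightarrow> real) \<Rightarrow> ('w \<Rightarrow> real) \<Rightarrow> bool" where
  "L0_le M f g \<longleftrightarrow> (AE \<omega> in M. f \<omega> \<le> g \<omega>)"

definition L0_less :: "'w measure \<Rightarrow> ('w \<Rightarrow> real) \<Rightarrow> ('w \<Rightarrow> real) \<Rightarrow> bool" where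
  "L0_less M f g \<longleftrightarrow> (AE \<omega> in M. f \<omega> < g \<omega>)"

definition L0pp :: "'w measure \<Rightarrow> ('w \<Rightarrow> real) set" where
  "L0pp M = {r \<in> L0 M. AE \<omega> in M. 0 < r \<omega>}"

definition is_partition :: "'w measure \<Rightarrow> (nat \<Rightarrow> 'w set) \<Rightarrow> bool" where
  "is_partition M A \<longleftrightarrow> (\<forall>k. A k \<in> sets M) \<and> disjoint_family A \<and> (\<Union>k. A k) = space M"

record ('w, 'a) L0_module =
  mcarrier :: "'a set"
  mzero :: 'a
  madd :: "'a \<Rightarrow> 'a \<Rightarrow> 'a"
  msmult :: "('w \<Rightarrow> real) \<Rightarrow> 'a \<Rightarrow> 'a"

definition is_L0_module :: "'w measure \<Rightarrow> ('w, 'a) L0_module \<Rightarrow> bool" where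
  "is_L0_module M E \<longleftrightarrow>
     mzero E \<in> mcarrier E \<and>
     (\<forall>x\<in>mcarrier E. \<forall>y\<in>mcarrier E. madd E x y \<in> mcarrier E) \<and>
     (\<forall>f\<in>L0 M. \<forall>x\<in>mcarrier E. msmult E f x \<in> mcarrier E) \<and>
     (\<forall>x\<in>mcarrier E. \<forall>y\<in>mcarrier E. \<forall>z\<in>mcarrier E.
        madd E (madd E x y) z = madd E x (madd E y z)) \<and>
     (\<forall>x\<in>mcarrier E. \<forall>y\<in>mcarrier E. madd E x y = madd E y x) \<and>
     (\<forall>x\<in>mcarrier E. madd E (mzero E) x = x) \<and>
     (\<forall>x\<in>mcarrier E. \<exists>y\<in>mcarrier E. madd E x y = mzero E) \<and>
     (\<forall>f\<in>L0 M. \<forall>x\<in>mcarrier E. \<forall>y\<in>mcarrier E.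
        msmult E f (madd E x y) = madd E (msmult E f x) (msmult E f y)) \<and>
     (\<forall>f\<in>L0 M. \<forall>g\<in>L0 M. \<forall>x\<in>mcarrier E.
        msmult E (\<lambda>\<omega>. f \<omega> + g \<omega>) x = madd E (msmult E f x) (msmult E g x)) \<and>
     (\<forall>f\<in>L0 M. \<forall>g\<in>L0 M. \<forall>x\<in>mcarrier E.
        msmult E (\<lambda>\<omega>. f \<omega> * g \<omega>) x = msmult E f (msmult E g x)) \<and>
     (\<forall>x\<in>mcarrier E. msmult E (\<lambda>_. 1) x = x) \<and>
     (\<forall>f\<in>L0 M. \<forall>g\<in>L0 M. L0_eq M f g \<longrightarrow> (\<forall>x\<in>mcarrier E. msmult E f x = msmult E g x))"

text \<open>x is the concatenation sum_k 1_{A_k} x_k\<close>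
definition is_concat :: "'w measure \<Rightarrow> ('w, 'a) L0_module \<Rightarrow> (nat \<Rightarrow> 'w set) \<Rightarrow> (nat \<Rightarrow> 'a) \<Rightarrow> 'a \<Rightarrow> bool" where
  "is_concat M E A xs x \<longleftrightarrow> x \<in> mcarrier E \<and>
     (\<forall>k. msmult E (indicator (A k)) x = msmult E (indicator (A k)) (xs k))"

definition stable_module :: "'w measure \<Rightarrow> ('w, 'a) L0_module \<Rightarrow> bool" where
  "stable_module M E \<longleftrightarrow> is_L0_module M E \<and>
     (\<forall>A xs. is_partition M A \<and> range xs \<subseteq> mcarrier E \<longrightarrow> (\<exists>!x. is_concat M E A xs x))"

definition concat :: "'w measure \<Rightarrow> ('w, 'a) L0_module \<Rightarrow> (nat \<Rightarrow> 'w set) \<Rightarrow> (nat \<Rightarrow> 'a) \<Rightarrow> 'a" where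
  "concat M E A xs = (THE x. is_concat M E A xs x)"

definition stable_set :: "'w measure \<Rightarrow> ('w, 'a) L0_module \<Rightarrow> 'a set \<Rightarrow> bool" where
  "stable_set M E S \<longleftrightarrow> S \<noteq> {} \<and> S \<subseteq> mcarrier E \<and>
     (\<forall>A xs. is_partition M A \<and> range xs \<subseteq> S \<longrightarrow> concat M E A xs \<in> S)"

definition concat_sets :: "'w measure \<Rightarrow> ('w, 'a) L0_module \<Rightarrow> (nat \<Rightarrow> 'w set) \<Rightarrow> (nat \<Rightarrow> 'a set) \<Rightarrow> 'a set" where
  "concat_sets M E A Ys = {concat M E A ys | ys. \<forall>k. ys k \<in> Ys k}"

definition stable_hull :: "'w measure \<Rightarrow> ('w, 'a) L0_module \<Rightarrow> 'a set \<Rightarrow> 'a set" where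
  "stable_hull M E X = {concat M E A xs | A xs. is_partition M A \<and> range xs \<subseteq> X}"

definition stable_finite :: "'w measure \<Rightarrow> ('w, 'a) L0_module \<Rightarrow> 'a set \<Rightarrow> 'a set \<Rightarrow> bool" where
  "stable_finite M E S N \<longleftrightarrow> (\<exists>A Xs. is_partition M A \<and>
      (\<forall>k. finite (Xs k) \<and> Xs k \<noteq> {} \<and> Xs k \<subseteq> S) \<and>
      N = concat_sets M E A (\<lambda>k. stable_hull M E (Xs k)))"

definition L0s_nat :: "'w measure \<Rightarrow> ('w \<Rightarrow> nat) set" where
  "L0s_nat M = {n. \<exists>A ns. is_partition M A \<and> (\<forall>k. \<forall>\<omega>\<in>A k. n \<omega> = ns k)}"

definition nat_le :: "'w measure \<Rightarrow> ('w \<Rightarrow> nat) \<Rightarrow> ('w \<Rightarrow> nat) \<Rightarrow> bool" where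
  "nat_le M n m \<longleftrightarrow> (AE \<omega> in M. n \<omega> \<le> m \<omega>)"

definition nat_less :: "'w measure \<Rightarrow> ('w \<Rightarrow> nat) \<Rightarrow> ('w \<Rightarrow> nat) \<Rightarrow> bool" where
  "nat_less M n m \<longleftrightarrow> (AE \<omega> in M. n \<omega> < m \<omega>)"

definition is_nat_concat :: "'w measure \<Rightarrow> (nat \<Rightarrow> 'w set) \<Rightarrow> (nat \<Rightarrow> 'w \<Rightarrow> nat) \<Rightarrow> ('w \<Rightarrow> nat) \<Rightarrow> bool" where
  "is_nat_concat M A ns m \<longleftrightarrow> (\<forall>k. AE \<omega> in M. \<omega> \<in> A k \<longrightarrow> m \<omega> = ns k \<omega>)"

definition stable_metric :: "'w measure \<Rightarrow> ('w, 'a) L0_module \<Rightarrow> 'a set \<Rightarrow> ('a \<Rightarrow> 'a \<Rightarrow> 'w \<Rightarrow> real) \<Rightarrow> bool" where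
  "stable_metric M E S d \<longleftrightarrow>
     (\<forall>x\<in>S. \<forall>y\<in>S. d x y \<in> L0 M \<and> (AE \<omega> in M. 0 \<le> d x y \<omega>)) \<and>
     (\<forall>x\<in>S. \<forall>y\<in>S. L0_eq M (d x y) (\<lambda>_. 0) \<longleftrightarrow> x = y) \<and>
     (\<forall>x\<in>S. \<forall>y\<in>S. L0_eq M (d x y) (d y x)) \<and>
     (\<forall>x\<in>S. \<forall>y\<in>S. \<forall>z\<in>S. L0_le M (d x z) (\<lambda>\<omega>. d x y \<omega> + d y z \<omega>)) \<and>
     (\<forall>A xs ys. is_partition M A \<and> range xs \<subseteq> S \<and> range ys \<subseteq> S \<longrightarrow>
        (\<forall>k. AE \<omega> in M. \<omega> \<in> A k \<longrightarrow>
           d (concat M E A xs) (concat M E A ys) \<omega> = d (xs k) (ys k) \<omega>))"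

definition sball :: "'w measure \<Rightarrow> 'a set \<Rightarrow> ('a \<Rightarrow> 'a \<Rightarrow> 'w \<Rightarrow> real) \<Rightarrow> 'a \<Rightarrow> ('w \<Rightarrow> real) \<Rightarrow> 'a set" where
  "sball M S d x r = {y \<in> S. L0_less M (d x y) r}"

definition sopen :: "'w measure \<Rightarrow> 'a set \<Rightarrow> ('a \<Rightarrow> 'a \<Rightarrow> 'w \<Rightarrow> real) \<Rightarrow> 'a set \<Rightarrow> bool" where
  "sopen M S d U \<longleftrightarrow> U \<subseteq> S \<and>
     (\<forall>y\<in>U. \<exists>x\<in>S. \<exists>r\<in>L0pp M. y \<in> sball M S d x r \<and> sball M S d x r \<subseteq> U)"

definition sclosed :: "'w measure \<Rightarrow> 'a set \<Rightarrow> ('a \<Rightarrow> 'a \<Rightarrow> 'w \<Rightarrow> real) \<Rightarrow> 'a set \<Rightarrow> bool" where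
  "sclosed M S d R \<longleftrightarrow> R \<subseteq> S \<and> sopen M S d (S - R)"

definition stable_seq :: "'w measure \<Rightarrow> ('w, 'a) L0_module \<Rightarrow> 'a set \<Rightarrow> (('w \<Rightarrow> nat) \<Rightarrow> 'a) \<Rightarrow> bool" where
  "stable_seq M E S X \<longleftrightarrow> (\<forall>n\<in>L0s_nat M. X n \<in> S) \<and>
     (\<forall>A ns m. is_partition M A \<and> range ns \<subseteq> L0s_nat M \<and> m \<in> L0s_nat M \<and> is_nat_concat M A ns m
        \<longrightarrow> X m = concat M E A (\<lambda>k. X (ns k)))"

definition stable_set_seq :: "'w measure \<Rightarrow> ('w, 'a) L0_module \<Rightarrow> (('w \<Rightarrow> nat) \<Rightarrow> 'a set) \<Rightarrow> bool" where
  "stable_set_seq M E R \<longleftrightarrow>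
     (\<forall>A ns m. is_partition M A \<and> range ns \<subseteq> L0s_nat M \<and> m \<in> L0s_nat M \<and> is_nat_concat M A ns m
        \<longrightarrow> R m = concat_sets M E A (\<lambda>k. R (ns k)))"

definition sconverges :: "'w measure \<Rightarrow> ('a \<Rightarrow> 'a \<Rightarrow> 'w \<Rightarrow> real) \<Rightarrow> (('w \<Rightarrow> nat) \<Rightarrow> 'a) \<Rightarrow> 'a \<Rightarrow> bool" where
  "sconverges M d X x \<longleftrightarrow> (\<forall>r\<in>L0pp M. \<exists>n0\<in>L0s_nat M. \<forall>n\<in>L0s_nat M.
      nat_le M n0 n \<longrightarrow> L0_less M (d (X n) x) r)"

definition scauchy :: "'w measure \<Rightarrow> ('a \<Rightarrow> 'a \<Rightarrow> 'w \<Rightarrow> real) \<Rightarrow> (('w \<Rightarrow> nat) \<Rightarrow> 'a) \<Rightarrow> bool" where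
  "scauchy M d X \<longleftrightarrow> (\<forall>r\<in>L0pp M. \<exists>n0\<in>L0s_nat M. \<forall>n\<in>L0s_nat M. \<forall>m\<in>L0s_nat M.
      nat_le M n0 n \<and> nat_le M n0 m \<longrightarrow> L0_le M (d (X n) (X m)) r)"

definition subseq_index :: "'w measure \<Rightarrow> (('w \<Rightarrow> nat) \<Rightarrow> ('w \<Rightarrow> nat)) \<Rightarrow> bool" where
  "subseq_index M N \<longleftrightarrow> (\<forall>k\<in>L0s_nat M. N k \<in> L0s_nat M) \<and>
     (\<forall>A ks m. is_partition M A \<and> range ks \<subseteq> L0s_nat M \<and> m \<in> L0s_nat M \<and> is_nat_concat M A ks m
        \<longrightarrow> is_nat_concat M A (\<lambda>j. N (ks j)) (N m)) \<and>
     (\<forall>k\<in>L0s_nat M. \<forall>k'\<in>L0s_nat M. nat_less M k k' \<longrightarrow> nat_less M (N k) (N k'))"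

definition stable_complete :: "'w measure \<Rightarrow> ('w, 'a) L0_module \<Rightarrow> 'a set \<Rightarrow> ('a \<Rightarrow> 'a \<Rightarrow> 'w \<Rightarrow> real) \<Rightarrow> bool" where
  "stable_complete M E S d \<longleftrightarrow>
     (\<forall>X. stable_seq M E S X \<and> scauchy M d X \<longrightarrow> (\<exists>x\<in>S. sconverges M d X x))"

definition stable_seq_compact :: "'w measure \<Rightarrow> ('w, 'a) L0_module \<Rightarrow> 'a set \<Rightarrow> ('a \<Rightarrow> 'a \<Rightarrow> 'w \<Rightarrow> real) \<Rightarrow> bool" where
  "stable_seq_compact M E S d \<longleftrightarrow>
     (\<forall>X. stable_seq M E S X \<longrightarrow>
        (\<exists>N. subseq_index M N \<and> (\<exists>x\<in>S. sconverges M d (X \<circ> N) x)))"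

definition stable_totally_bounded :: "'w measure \<Rightarrow> ('w, 'a) L0_module \<Rightarrow> 'a set \<Rightarrow> ('a \<Rightarrow> 'a \<Rightarrow> 'w \<Rightarrow> real) \<Rightarrow> bool" where
  "stable_totally_bounded M E S d \<longleftrightarrow>
     (\<forall>r\<in>L0pp M. \<exists>N. stable_finite M E S N \<and> S = (\<Union>x\<in>N. sball M S d x r))"

definition is_filter_on :: "'a set \<Rightarrow> 'a set set \<Rightarrow> bool" where
  "is_filter_on S F \<longleftrightarrow> F \<subseteq> Pow S \<and> S \<in> F \<and> {} \<notin> F \<and>
     (\<forall>U\<in>F. \<forall>V. U \<subseteq> V \<and> V \<subseteq> S \<longrightarrow> V \<in> F) \<and> (\<forall>U\<in>F. \<forall>V\<in>F. U \<inter> V \<in> F)"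

definition is_filter_base :: "'a set set \<Rightarrow> 'a set set \<Rightarrow> bool" where
  "is_filter_base F B \<longleftrightarrow> B \<subseteq> F \<and> (\<forall>U\<in>F. \<exists>V\<in>B. V \<subseteq> U)"

definition stable_collection :: "'w measure \<Rightarrow> ('w, 'a) L0_module \<Rightarrow> 'a set set \<Rightarrow> bool" where
  "stable_collection M E B \<longleftrightarrow> B \<noteq> {} \<and> (\<forall>V\<in>B. stable_set M E V) \<and>
     (\<forall>A Vs. is_partition M A \<and> range Vs \<subseteq> B \<longrightarrow> concat_sets M E A Vs \<in> B)"

definition stable_filter :: "'w measure \<Rightarrow> ('w, 'a) L0_module \<Rightarrow> 'a set \<Rightarrow> 'a set set \<Rightarrow> bool" where
  "stable_filter M E S F \<longleftrightarrow> is_filter_on S F \<and>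
     (\<exists>B. is_filter_base F B \<and> stable_collection M E B)"

definition cluster_point :: "'w measure \<Rightarrow> 'a set \<Rightarrow> ('a \<Rightarrow> 'a \<Rightarrow> 'w \<Rightarrow> real) \<Rightarrow> 'a set set \<Rightarrow> 'a \<Rightarrow> bool" where
  "cluster_point M S d F x \<longleftrightarrow> x \<in> S \<and>
     (\<forall>U\<in>F. \<forall>V. sopen M S d V \<and> x \<in> V \<longrightarrow> V \<inter> U \<noteq> {})"

definition stable_compact :: "'w measure \<Rightarrow> ('w, 'a) L0_module \<Rightarrow> 'a set \<Rightarrow> ('a \<Rightarrow> 'a \<Rightarrow> 'w \<Rightarrow> real) \<Rightarrow> bool" where
  "stable_compact M E S d \<longleftrightarrow>
     (\<forall>F. stable_filter M E S F \<longrightarrow> (\<exists>x\<in>S. cluster_point M S d F x))"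

definition decreasing_closed_property :: "'w measure \<Rightarrow> ('w, 'a) L0_module \<Rightarrow> 'a set \<Rightarrow> ('a \<Rightarrow> 'a \<Rightarrow> 'w \<Rightarrow> real) \<Rightarrow> bool" where
  "decreasing_closed_property M E S d \<longleftrightarrow>
     (\<forall>R. stable_set_seq M E R \<and>
          (\<forall>n\<in>L0s_nat M. stable_set M E (R n) \<and> sclosed M S d (R n)) \<and>
          (\<forall>n\<in>L0s_nat M. \<forall>m\<in>L0s_nat M. nat_le M n m \<longrightarrow> R m \<subseteq> R n)
        \<longrightarrow> (\<Inter>n\<in>L0s_nat M. R n) \<noteq> {})"

end

theory Submission
  imports Defs
begin

text \<open>
  Concatenations in \<open>S\<close> are determined by the metric, so the module structure plays no further
  role and everything is argued pointwise in \<open>\<omega>\<close>: a stable sequence is an ordinary sequence \<open>x\<close>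
  evaluated at a random index, so that it converges, is Cauchy, or has a convergent stable
  subsequence iff at almost every \<open>\<omega>\<close> the sequence \<open>x\<close> converges, is Cauchy, or clusters with
  respect to the pseudometric \<open>d _ _ \<omega>\<close>.

  A stable sequence has a cluster point because the sets of those \<open>y\<close> to which the tail of \<open>x\<close>
  from \<open>n \<omega>\<close> on comes arbitrarily close are stable, closed and decreasing in \<open>n\<close>. For total
  boundedness, choose \<open>x k\<close> greedily so that the event on which it has distance at least \<open>r\<close> from
  all earlier points is essentially largest. A cluster point forces some pair \<open>i < k\<close> with
  \<open>d (x i) (x k) \<omega> < r \<omega>\<close> at almost every \<open>\<omega>\<close>, and maximality turns the points before \<open>x k\<close> into
  an \<open>r\<close>-net at \<open>\<omega>\<close>. Conversely, given a stable filter base, nets of radius \<open>1 / (k + 1)\<close> yield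
  points \<open>y k\<close> such that every member of the base meets the first \<open>k\<close> balls simultaneously; the
  limit of the Cauchy sequence \<open>y\<close> is a cluster point.
\<close>

section \<open>Random indices and almost sure statements\<close>

lemma ex_from_nat_into_less_card:
  assumes "finite X" "x \<in> X"
  shows "\<exists>i<card X. x = from_nat_into X i"
  using bij_betw_from_nat_into_finite[OF assms(1)] assms(2) unfolding bij_betw_def by blast

lemma is_partition_cover: "is_partition M A \<Longrightarrow> \<omega> \<in> space M \<Longrightarrow> \<exists>k. \<omega> \<in> A k"
  unfolding is_partition_def by blast

lemma L0s_nat_eq_measurable: "L0s_nat M = M \<rightarrow>\<^sub>M count_space UNIV"
proof (intro set_eqI iffI)
  fix n assume "n \<in> L0s_nat M"
  then obtain A ns where A: "is_partition M A" and n: "\<And>k \<omega>. \<omega> \<in> A k \<Longrightarrow> n \<omega> = ns k"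
    by (auto simp: L0s_nat_def)
  show "n \<in> M \<rightarrow>\<^sub>M count_space UNIV"
  proof (rule measurable_piecewise_restrict[where C = "range A"])
    fix B assume "B \<in> range A"
    then obtain k where "B = A k" by blast
    then have "n \<omega> = ns k" if "\<omega> \<in> space (restrict_space M B)" for \<omega>
      using n that by (simp add: space_restrict_space)
    then show "n \<in> restrict_space M B \<rightarrow>\<^sub>M count_space UNIV"
      using measurable_cong[of _ n "\<lambda>_. ns k"] by simp
  qed (use A in \<open>auto simp: is_partition_def\<close>)
next
  fix n :: "'a \<Rightarrow> nat" assume [measurable]: "n \<in> M \<rightarrow>\<^sub>M count_space UNIV"
  have "is_partition M (\<lambda>j. {\<omega> \<in> space M. n \<omega> = j})"
    by (auto simp: is_partition_def disjoint_family_on_def)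
  then show "n \<in> L0s_nat M"
    unfolding L0s_nat_def
    by (intro CollectI exI[of _ "\<lambda>j. {\<omega> \<in> space M. n \<omega> = j}"] exI[of _ id]) auto
qed

lemma measurable_L0s_nat [measurable_dest]: "n \<in> L0s_nat M \<Longrightarrow> n \<in> M \<rightarrow>\<^sub>M count_space UNIV"
  by (simp add: L0s_nat_eq_measurable)

lemma L0s_nat_const: "(\<lambda>_. k) \<in> L0s_nat M"
  by (simp add: L0s_nat_eq_measurable)

lemma L0s_nat_max: "n \<in> L0s_nat M \<Longrightarrow> m \<in> L0s_nat M \<Longrightarrow> (\<lambda>\<omega>. max (n \<omega>) (m \<omega>)) \<in> L0s_nat M"
  by (simp add: L0s_nat_eq_measurable)

lemma L0s_nat_If: "A \<in> sets M \<Longrightarrow> (\<lambda>\<omega>. if \<omega> \<in> A then i else j) \<in> L0s_nat M"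
  by (simp add: L0s_nat_eq_measurable)

lemma L0s_nat_Least:
  assumes [measurable]: "\<And>k. Measurable.pred M (P k)"
  shows "(\<lambda>\<omega>. LEAST k. P k \<omega>) \<in> L0s_nat M"
  unfolding L0s_nat_eq_measurable by measurable

lemma L0s_nat_compose:
  assumes "\<And>k. ns k \<in> L0s_nat M" "i \<in> L0s_nat M"
  shows "(\<lambda>\<omega>. ns (i \<omega>) \<omega>) \<in> L0s_nat M"
  using measurable_compose_countable assms unfolding L0s_nat_eq_measurable by blast

lemma is_partition_level_sets: "n \<in> L0s_nat M \<Longrightarrow> is_partition M (\<lambda>j. {\<omega> \<in> space M. n \<omega> = j})"
  by (auto simp: is_partition_def disjoint_family_on_def)

lemma is_partition_index:
  assumes "is_partition M A"
  obtains n where "n \<in> L0s_nat M" "\<And>k \<omega>. \<omega> \<in> A k \<Longrightarrow> n \<omega> = k"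
proof -
  define n where "n \<omega> = (THE k. \<omega> \<in> A k)" for \<omega>
  have n: "n \<omega> = k" if "\<omega> \<in> A k" for \<omega> k
    unfolding n_def using assms that
    by (intro the_equality) (auto simp: is_partition_def disjoint_family_on_def)
  then have "n \<in> L0s_nat M"
    using assms unfolding L0s_nat_def by (intro CollectI exI[of _ A] exI[of _ id]) auto
  then show ?thesis by (rule that) (rule n)
qed

lemma L0pp_const: "0 < c \<Longrightarrow> (\<lambda>_. c) \<in> L0pp M"
  by (simp add: L0pp_def L0_def)

lemma L0pp_half: "r \<in> L0pp M \<Longrightarrow> (\<lambda>\<omega>. r \<omega> / 2) \<in> L0pp M"
  by (auto simp: L0pp_def L0_def)

lemma L0pp_pos: "r \<in> L0pp M \<Longrightarrow> AE \<omega> in M. 0 < r \<omega>"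
  by (simp add: L0pp_def)

lemma measurable_L0pp [measurable_dest]: "r \<in> L0pp M \<Longrightarrow> r \<in> borel_measurable M"
  by (simp add: L0pp_def L0_def)

lemma all_L0pp_AE_iff:
  fixes P :: "real \<Rightarrow> 'w \<Rightarrow> bool"
  assumes mono: "\<And>e e' \<omega>. P e \<omega> \<Longrightarrow> e \<le> e' \<Longrightarrow> P e' \<omega>"
  shows "(\<forall>r\<in>L0pp M. AE \<omega> in M. P (r \<omega>) \<omega>) \<longleftrightarrow> (AE \<omega> in M. \<forall>e>0. P e \<omega>)"
proof
  assume all: "\<forall>r\<in>L0pp M. AE \<omega> in M. P (r \<omega>) \<omega>"
  have "AE \<omega> in M. P (inverse (real (Suc k))) \<omega>" for k
    using bspec[OF all L0pp_const[of "inverse (real (Suc k))"]] by simp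
  then have "AE \<omega> in M. \<forall>k. P (inverse (real (Suc k))) \<omega>"
    unfolding AE_all_countable ..
  then show "AE \<omega> in M. \<forall>e>0. P e \<omega>"
  proof eventually_elim
    case (elim \<omega>)
    then show ?case using mono reals_Archimedean less_imp_le by metis
  qed
next
  assume P: "AE \<omega> in M. \<forall>e>0. P e \<omega>"
  show "\<forall>r\<in>L0pp M. AE \<omega> in M. P (r \<omega>) \<omega>"
  proof
    fix r assume "r \<in> L0pp M"
    from L0pp_pos[OF this] P show "AE \<omega> in M. P (r \<omega>) \<omega>" by eventually_elim simp
  qed
qed

lemma ex_L0s_nat_tail_iff:
  fixes P :: "nat \<Rightarrow> nat \<Rightarrow> 'w \<Rightarrow> bool"
  assumes [measurable]: "\<And>i j. Measurable.pred M (P i j)"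
  shows "(\<exists>n0\<in>L0s_nat M. \<forall>n\<in>L0s_nat M. \<forall>m\<in>L0s_nat M.
      nat_le M n0 n \<and> nat_le M n0 m \<longrightarrow> (AE \<omega> in M. P (n \<omega>) (m \<omega>) \<omega>)) \<longleftrightarrow>
    (AE \<omega> in M. \<exists>N. \<forall>i\<ge>N. \<forall>j\<ge>N. P i j \<omega>)"
proof
  assume "\<exists>n0\<in>L0s_nat M. \<forall>n\<in>L0s_nat M. \<forall>m\<in>L0s_nat M.
    nat_le M n0 n \<and> nat_le M n0 m \<longrightarrow> (AE \<omega> in M. P (n \<omega>) (m \<omega>) \<omega>)"
  then obtain n0 where n0: "n0 \<in> L0s_nat M"
    and tail: "\<And>n m. n \<in> L0s_nat M \<Longrightarrow> m \<in> L0s_nat M \<Longrightarrow> nat_le M n0 n \<Longrightarrow> nat_le M n0 m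
      \<Longrightarrow> AE \<omega> in M. P (n \<omega>) (m \<omega>) \<omega>" by blast
  have "AE \<omega> in M. P (max i (n0 \<omega>)) (max j (n0 \<omega>)) \<omega>" for i j
    by (rule tail) (simp_all add: nat_le_def L0s_nat_max L0s_nat_const n0)
  then have "AE \<omega> in M. \<forall>i j. P (max i (n0 \<omega>)) (max j (n0 \<omega>)) \<omega>"
    by (simp add: AE_all_countable)
  then show "AE \<omega> in M. \<exists>N. \<forall>i\<ge>N. \<forall>j\<ge>N. P i j \<omega>"
    by eventually_elim (metis max.absorb1)
next
  assume ex_tail: "AE \<omega> in M. \<exists>N. \<forall>i\<ge>N. \<forall>j\<ge>N. P i j \<omega>"
  define n0 where "n0 \<omega> = (LEAST N. \<forall>i\<ge>N. \<forall>j\<ge>N. P i j \<omega>)" for \<omega>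
  have "n0 \<in> L0s_nat M" unfolding n0_def by (rule L0s_nat_Least) measurable
  moreover have "AE \<omega> in M. P (n \<omega>) (m \<omega>) \<omega>" if "nat_le M n0 n" "nat_le M n0 m" for n m
    using ex_tail that unfolding nat_le_def
  proof eventually_elim
    case (elim \<omega>)
    from elim(1) have "\<forall>i\<ge>n0 \<omega>. \<forall>j\<ge>n0 \<omega>. P i j \<omega>" unfolding n0_def by (rule LeastI_ex)
    with elim(2,3) show ?case by blast
  qed
  ultimately show "\<exists>n0\<in>L0s_nat M. \<forall>n\<in>L0s_nat M. \<forall>m\<in>L0s_nat M.
      nat_le M n0 n \<and> nat_le M n0 m \<longrightarrow> (AE \<omega> in M. P (n \<omega>) (m \<omega>) \<omega>)" by blast
qed

lemma ex_L0s_nat_tail_iff_eventually: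
  fixes P :: "nat \<Rightarrow> 'w \<Rightarrow> bool"
  assumes "\<And>j. Measurable.pred M (P j)"
  shows "(\<exists>n0\<in>L0s_nat M. \<forall>n\<in>L0s_nat M. nat_le M n0 n \<longrightarrow> (AE \<omega> in M. P (n \<omega>) \<omega>)) \<longleftrightarrow>
    (AE \<omega> in M. \<forall>\<^sub>F j in sequentially. P j \<omega>)"
proof -
  have "(\<exists>n0\<in>L0s_nat M. \<forall>n\<in>L0s_nat M. nat_le M n0 n \<longrightarrow> (AE \<omega> in M. P (n \<omega>) \<omega>)) \<longleftrightarrow>
      (\<exists>n0\<in>L0s_nat M. \<forall>n\<in>L0s_nat M. \<forall>m\<in>L0s_nat M.
        nat_le M n0 n \<and> nat_le M n0 m \<longrightarrow> (AE \<omega> in M. P (n \<omega>) \<omega>))"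
    by blast
  also have "\<dots> \<longleftrightarrow> (AE \<omega> in M. \<exists>N. \<forall>i\<ge>N. \<forall>j\<ge>N. P i \<omega>)"
    using ex_L0s_nat_tail_iff[where P = "\<lambda>i j. P i"] assms .
  also have "\<dots> \<longleftrightarrow> (AE \<omega> in M. \<forall>\<^sub>F j in sequentially. P j \<omega>)"
    unfolding eventually_sequentially by (intro AE_cong) blast
  finally show ?thesis .
qed

lemma ex_random_subseq:
  fixes P :: "nat \<Rightarrow> nat \<Rightarrow> 'w \<Rightarrow> bool"
  assumes [measurable]: "\<And>k j. Measurable.pred M (P k j)"
    and freq: "AE \<omega> in M. \<forall>k. \<exists>\<^sub>F j in sequentially. P k j \<omega>"
  shows "\<exists>t. (\<forall>k. t k \<in> L0s_nat M) \<and>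
    (AE \<omega> in M. strict_mono (\<lambda>k. t k \<omega>) \<and> (\<forall>k. P k (t k \<omega>) \<omega>))"
proof -
  define s where "s = rec_nat (\<lambda>_. 0) (\<lambda>k f \<omega>. LEAST j. f \<omega> < j \<and> P k j \<omega>)"
  have s_Suc: "s (Suc k) = (\<lambda>\<omega>. LEAST j. s k \<omega> < j \<and> P k j \<omega>)" for k
    by (simp add: s_def)
  have s: "s k \<in> L0s_nat M" for k
  proof (induction k)
    case 0
    show ?case by (simp add: s_def L0s_nat_const)
  next
    case (Suc k)
    note [measurable] = Suc.IH
    show ?case unfolding s_Suc by (rule L0s_nat_Least) measurable
  qed
  have "AE \<omega> in M. \<forall>k. s k \<omega> < s (Suc k) \<omega> \<and> P k (s (Suc k) \<omega>) \<omega>"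
    using freq
  proof eventually_elim
    case (elim \<omega>)
    have "\<exists>j. s k \<omega> < j \<and> P k j \<omega>" for k
      using elim unfolding frequently_sequentially by (meson Suc_le_eq)
    from LeastI_ex[OF this] show ?case by (simp add: s_Suc)
  qed
  then have "AE \<omega> in M. strict_mono (\<lambda>k. s (Suc k) \<omega>) \<and> (\<forall>k. P k (s (Suc k) \<omega>) \<omega>)"
    by eventually_elim (simp add: strict_mono_Suc_iff)
  with s show ?thesis by (intro exI[of _ "\<lambda>k. s (Suc k)"] conjI allI)
qed

lemma ex_maximal_emeasure:
  assumes "I \<noteq> {}" and Q: "\<And>i. i \<in> I \<Longrightarrow> Measurable.pred M (Q i)"
    and upper: "\<And>xs :: nat \<Rightarrow> 'i. range xs \<subseteq> I \<Longrightarrow> \<exists>u\<in>I. AE \<omega> in M. (\<exists>k. Q (xs k) \<omega>) \<longrightarrow> Q u \<omega>"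
  shows "\<exists>u\<in>I. \<forall>v\<in>I. emeasure M {\<omega> \<in> space M. Q v \<omega>} \<le> emeasure M {\<omega> \<in> space M. Q u \<omega>}"
proof -
  define p where "p i = emeasure M {\<omega> \<in> space M. Q i \<omega>}" for i
  obtain f :: "nat \<Rightarrow> ennreal" where f: "range f \<subseteq> p ` I" "Sup (p ` I) = Sup (range f)"
    using ennreal_Sup_countable_SUP[of "p ` I"] \<open>I \<noteq> {}\<close> by auto
  then have "\<exists>i\<in>I. f k = p i" for k by blast
  then obtain xs where xs: "\<And>k. xs k \<in> I" "\<And>k. f k = p (xs k)" by metis
  then obtain u where u: "u \<in> I" "AE \<omega> in M. (\<exists>k. Q (xs k) \<omega>) \<longrightarrow> Q u \<omega>"
    using upper[of xs] by blast
  note [measurable] = Q[OF u(1)]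
  have "f k \<le> p u" for k
    unfolding xs(2) p_def using u(2) by (intro emeasure_mono_AE) auto
  then have "p v \<le> p u" if "v \<in> I" for v
    using SUP_upper[OF that, of p] SUP_least[of UNIV f "p u"] f(2) by simp
  with u(1) show ?thesis unfolding p_def by blast
qed

lemma (in finite_measure) AE_imp_if_emeasure_disj_le:
  assumes [measurable]: "Measurable.pred M P" "Measurable.pred M Q"
    and le: "emeasure M {\<omega> \<in> space M. P \<omega> \<or> Q \<omega>} \<le> emeasure M {\<omega> \<in> space M. P \<omega>}"
  shows "AE \<omega> in M. Q \<omega> \<longrightarrow> P \<omega>"
proof -
  have "emeasure M ({\<omega> \<in> space M. P \<omega> \<or> Q \<omega>} - {\<omega> \<in> space M. P \<omega>}) = 0"
    using le by (subst emeasure_Diff) (auto simp: diff_eq_0_iff_ennreal less_top[symmetric])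
  then have "{\<omega> \<in> space M. P \<omega> \<or> Q \<omega>} - {\<omega> \<in> space M. P \<omega>} \<in> null_sets M"
    by (intro null_setsI) simp_all
  from AE_not_in[OF this] AE_space show ?thesis by eventually_elim auto
qed

lemma (in finite_measure) ex_essentially_largest:
  fixes Q :: "'i \<Rightarrow> 'a \<Rightarrow> bool"
  assumes "I \<noteq> {}" and Q: "\<And>i. i \<in> I \<Longrightarrow> Measurable.pred M (Q i)"
    and upper: "\<And>xs :: nat \<Rightarrow> 'i. range xs \<subseteq> I \<Longrightarrow> \<exists>u\<in>I. AE \<omega> in M. (\<exists>k. Q (xs k) \<omega>) \<longrightarrow> Q u \<omega>"
  shows "\<exists>u\<in>I. \<forall>v\<in>I. AE \<omega> in M. Q v \<omega> \<longrightarrow> Q u \<omega>"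
proof -
  obtain u where u: "u \<in> I"
    and max: "\<And>v. v \<in> I \<Longrightarrow> emeasure M {\<omega> \<in> space M. Q v \<omega>} \<le> emeasure M {\<omega> \<in> space M. Q u \<omega>}"
    using ex_maximal_emeasure[OF assms] by blast
  have "AE \<omega> in M. Q v \<omega> \<longrightarrow> Q u \<omega>" if v: "v \<in> I" for v
  proof (rule AE_imp_if_emeasure_disj_le[OF Q[OF u] Q[OF v]])
    obtain w where w: "w \<in> I" "AE \<omega> in M. (\<exists>k. Q (if k = (0::nat) then u else v) \<omega>) \<longrightarrow> Q w \<omega>"
      using upper[of "\<lambda>k. if k = 0 then u else v"] u v by auto
    note [measurable] = Q[OF w(1)]
    have "AE \<omega> in M. Q u \<omega> \<or> Q v \<omega> \<longrightarrow> Q w \<omega>"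
      using w(2) by eventually_elim (metis (full_types) one_neq_zero)
    then have "emeasure M {\<omega> \<in> space M. Q u \<omega> \<or> Q v \<omega>} \<le> emeasure M {\<omega> \<in> space M. Q w \<omega>}"
      by (intro emeasure_mono_AE) auto
    also have "\<dots> \<le> emeasure M {\<omega> \<in> space M. Q u \<omega>}" by (rule max[OF w(1)])
    finally show "emeasure M {\<omega> \<in> space M. Q u \<omega> \<or> Q v \<omega>} \<le> emeasure M {\<omega> \<in> space M. Q u \<omega>}" .
  qed
  with u show ?thesis by blast
qed

section \<open>Stable metric spaces\<close>

locale stable_metric_space = finite_measure M for M :: "'w measure" +
  fixes E :: "('w, 'a) L0_module" and S :: "'a set" and d :: "'a \<Rightarrow> 'a \<Rightarrow> 'w \<Rightarrow> real"
  assumes stable_module: "stable_module M E"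
    and stable_set: "stable_set M E S"
    and stable_metric: "stable_metric M E S d"
begin

lemma d_measurable: "x \<in> S \<Longrightarrow> y \<in> S \<Longrightarrow> d x y \<in> borel_measurable M"
  using stable_metric by (auto simp: stable_metric_def L0_def)

lemma pred_d_less:
  assumes "x \<in> S" "y \<in> S" and [measurable]: "r \<in> borel_measurable M"
  shows "Measurable.pred M (\<lambda>\<omega>. d x y \<omega> < r \<omega>)"
proof -
  note [measurable] = d_measurable[OF assms(1,2)]
  show ?thesis by measurable
qed

lemma AE_d_eq_0_iff: "x \<in> S \<Longrightarrow> y \<in> S \<Longrightarrow> (AE \<omega> in M. d x y \<omega> = 0) \<longleftrightarrow> x = y"
  using stable_metric by (auto simp: stable_metric_def L0_eq_def)

lemma d_self: "x \<in> S \<Longrightarrow> AE \<omega> in M. d x x \<omega> = 0"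
  by (simp add: AE_d_eq_0_iff)

lemma d_commute: "x \<in> S \<Longrightarrow> y \<in> S \<Longrightarrow> AE \<omega> in M. d x y \<omega> = d y x \<omega>"
  using stable_metric by (auto simp: stable_metric_def L0_eq_def)

lemma d_triangle:
  "x \<in> S \<Longrightarrow> y \<in> S \<Longrightarrow> z \<in> S \<Longrightarrow> AE \<omega> in M. d x z \<omega> \<le> d x y \<omega> + d y z \<omega>"
  using stable_metric by (auto simp: stable_metric_def L0_le_def)

lemma d_triangle2:
  assumes "x \<in> S" "y \<in> S" "z \<in> S"
  shows "AE \<omega> in M. d x y \<omega> \<le> d x z \<omega> + d y z \<omega>"
  using d_triangle[OF assms(1,3,2)] d_commute[OF assms(2,3)] by eventually_elim simp

lemma d_cong:
  assumes "x \<in> S" "y \<in> S" "z \<in> S"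
  shows "AE \<omega> in M. d x y \<omega> = 0 \<longrightarrow> d z x \<omega> = d z y \<omega>"
  using d_triangle[OF assms(3,1,2)] d_triangle2[OF assms(3,1,2)] d_commute[OF assms(1,2)]
    d_triangle[OF assms(3,2,1)]
  by eventually_elim simp

subsection \<open>Concatenation and selection\<close>

lemma concat_in: "is_partition M A \<Longrightarrow> range xs \<subseteq> S \<Longrightarrow> concat M E A xs \<in> S"
  using stable_set by (auto simp: stable_set_def)

lemma concat_const:
  assumes "is_partition M A" "x \<in> S"
  shows "concat M E A (\<lambda>_. x) = x"
proof -
  have x: "x \<in> mcarrier E" using assms stable_set by (auto simp: stable_set_def)
  then have "\<exists>!z. is_concat M E A (\<lambda>_. x) z"
    using stable_module assms by (auto simp: stable_module_def)
  moreover have "is_concat M E A (\<lambda>_. x) x" using x by (simp add: is_concat_def)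
  ultimately show ?thesis unfolding concat_def by (simp add: the1_equality)
qed

lemma d_concat_concat:
  "is_partition M A \<Longrightarrow> range xs \<subseteq> S \<Longrightarrow> range ys \<subseteq> S \<Longrightarrow>
    AE \<omega> in M. \<forall>k. \<omega> \<in> A k \<longrightarrow> d (concat M E A xs) (concat M E A ys) \<omega> = d (xs k) (ys k) \<omega>"
  using stable_metric by (auto simp: stable_metric_def AE_all_countable)

lemma d_concat_left:
  assumes "is_partition M A" "range xs \<subseteq> S" "y \<in> S"
  shows "AE \<omega> in M. \<forall>k. \<omega> \<in> A k \<longrightarrow> d (concat M E A xs) y \<omega> = d (xs k) y \<omega>"
  using d_concat_concat[of A xs "\<lambda>_. y"] assms by (simp add: concat_const image_subset_iff)

lemma d_concat_right:
  assumes "is_partition M A" "range xs \<subseteq> S" "y \<in> S"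
  shows "AE \<omega> in M. \<forall>k. \<omega> \<in> A k \<longrightarrow> d y (concat M E A xs) \<omega> = d y (xs k) \<omega>"
  using d_concat_concat[of A "\<lambda>_. y" xs] assms by (simp add: concat_const image_subset_iff)

lemma concat_eq_iff:
  assumes A: "is_partition M A" and xs: "range xs \<subseteq> S" and z: "z \<in> S"
  shows "concat M E A xs = z \<longleftrightarrow> (\<forall>k. AE \<omega>\<in>A k in M. d z (xs k) \<omega> = 0)"
proof
  assume "concat M E A xs = z"
  then have "AE \<omega> in M. \<forall>k. \<omega> \<in> A k \<longrightarrow> d z (xs k) \<omega> = 0"
    using d_concat_right[OF A xs z] d_self[OF z] by (auto elim: eventually_elim2)
  then show "\<forall>k. AE \<omega>\<in>A k in M. d z (xs k) \<omega> = 0" by (simp add: AE_all_countable)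
next
  assume "\<forall>k. AE \<omega>\<in>A k in M. d z (xs k) \<omega> = 0"
  then have "AE \<omega> in M. \<forall>k. \<omega> \<in> A k \<longrightarrow> d z (xs k) \<omega> = 0" by (simp add: AE_all_countable)
  with d_concat_right[OF A xs z] AE_space have "AE \<omega> in M. d z (concat M E A xs) \<omega> = 0"
    by eventually_elim (metis is_partition_cover[OF A])
  then show "concat M E A xs = z" using AE_d_eq_0_iff[OF z concat_in[OF A xs]] by simp
qed

lemma mem_concat_sets_iff:
  assumes A: "is_partition M A" and Y: "\<And>k. Y k \<subseteq> S"
  shows "x \<in> concat_sets M E A Y \<longleftrightarrow>
    x \<in> S \<and> (\<forall>k. \<exists>y\<in>Y k. AE \<omega>\<in>A k in M. d x y \<omega> = 0)"
proof
  assume "x \<in> concat_sets M E A Y"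
  then obtain ys where ys: "x = concat M E A ys" "\<forall>k. ys k \<in> Y k"
    by (auto simp: concat_sets_def)
  moreover from this Y have "range ys \<subseteq> S" by blast
  moreover from this ys have "x \<in> S" using concat_in A by simp
  ultimately show "x \<in> S \<and> (\<forall>k. \<exists>y\<in>Y k. AE \<omega>\<in>A k in M. d x y \<omega> = 0)"
    using concat_eq_iff[OF A] by blast
next
  assume agree: "x \<in> S \<and> (\<forall>k. \<exists>y\<in>Y k. AE \<omega>\<in>A k in M. d x y \<omega> = 0)"
  then obtain ys where ys: "\<And>k. ys k \<in> Y k" "\<And>k. AE \<omega>\<in>A k in M. d x (ys k) \<omega> = 0"
    by metis
  then have "concat M E A ys = x"
    using concat_eq_iff[OF A, of ys x] agree Y by blast
  then show "x \<in> concat_sets M E A Y" using ys(1) by (auto simp: concat_sets_def)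
qed

definition select :: "(nat \<Rightarrow> 'a) \<Rightarrow> ('w \<Rightarrow> nat) \<Rightarrow> 'a"
  where "select xs n = concat M E (\<lambda>j. {\<omega> \<in> space M. n \<omega> = j}) xs"

lemma select_in_stable_set:
  "stable_set M E U \<Longrightarrow> n \<in> L0s_nat M \<Longrightarrow> range xs \<subseteq> U \<Longrightarrow> select xs n \<in> U"
  unfolding stable_set_def select_def using is_partition_level_sets by blast

lemma select_in: "n \<in> L0s_nat M \<Longrightarrow> range xs \<subseteq> S \<Longrightarrow> select xs n \<in> S"
  by (rule select_in_stable_set[OF stable_set])

lemma d_select_left:
  assumes "n \<in> L0s_nat M" "range xs \<subseteq> S" "y \<in> S"
  shows "AE \<omega> in M. d (select xs n) y \<omega> = d (xs (n \<omega>)) y \<omega>"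
  using d_concat_left[OF is_partition_level_sets[OF assms(1)] assms(2,3)] AE_space
  by eventually_elim (simp add: select_def)

lemma d_select_right:
  assumes "n \<in> L0s_nat M" "range xs \<subseteq> S" "y \<in> S"
  shows "AE \<omega> in M. d y (select xs n) \<omega> = d y (xs (n \<omega>)) \<omega>"
  using d_concat_right[OF is_partition_level_sets[OF assms(1)] assms(2,3)] AE_space
  by eventually_elim (simp add: select_def)

lemma d_select_select:
  assumes "n \<in> L0s_nat M" "m \<in> L0s_nat M" "range xs \<subseteq> S" "range ys \<subseteq> S"
  shows "AE \<omega> in M. d (select xs n) (select ys m) \<omega> = d (xs (n \<omega>)) (ys (m \<omega>)) \<omega>"
proof -
  have "AE \<omega> in M. \<forall>k. d (xs k) (select ys m) \<omega> = d (xs k) (ys (m \<omega>)) \<omega>"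
    unfolding AE_all_countable using d_select_right[OF assms(2,4)] assms(3) by blast
  with d_select_left[OF assms(1,3) select_in[OF assms(2,4)]] show ?thesis
    by eventually_elim simp
qed

lemma AE_d_select_eq_0:
  assumes "n \<in> L0s_nat M" "range xs \<subseteq> S"
  shows "AE \<omega> in M. d (xs (n \<omega>)) (select xs n) \<omega> = 0"
  using d_select_left[OF assms select_in[OF assms]] d_self[OF select_in[OF assms]]
  by eventually_elim simp

lemma select_const:
  assumes "range xs \<subseteq> S"
  shows "select xs (\<lambda>_. j) = xs j"
proof -
  have xs: "xs j \<in> S" using assms by blast
  have "is_partition M (\<lambda>i. {\<omega> \<in> space M. j = i})"
    by (rule is_partition_level_sets[OF L0s_nat_const])
  then show ?thesis
    unfolding select_def using concat_eq_iff[OF _ assms xs] d_self[OF xs] by auto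
qed

definition paste :: "'w set \<Rightarrow> 'a \<Rightarrow> 'a \<Rightarrow> 'a"
  where "paste A x y = select (\<lambda>k. if k = 0 then x else y) (\<lambda>\<omega>. if \<omega> \<in> A then 0 else 1)"

lemma paste_in_stable_set:
  "stable_set M E U \<Longrightarrow> A \<in> sets M \<Longrightarrow> x \<in> U \<Longrightarrow> y \<in> U \<Longrightarrow> paste A x y \<in> U"
  unfolding paste_def by (rule select_in_stable_set) (auto intro: L0s_nat_If)

lemma paste_in: "A \<in> sets M \<Longrightarrow> x \<in> S \<Longrightarrow> y \<in> S \<Longrightarrow> paste A x y \<in> S"
  by (rule paste_in_stable_set[OF stable_set])

lemma d_paste:
  assumes "A \<in> sets M" "x \<in> S" "y \<in> S" "z \<in> S"
  shows "AE \<omega> in M. d z (paste A x y) \<omega> = (if \<omega> \<in> A then d z x \<omega> else d z y \<omega>)"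
  using d_select_right[of "\<lambda>\<omega>. if \<omega> \<in> A then 0 else 1" "\<lambda>k. if k = 0 then x else y" z] assms
  by (auto simp: paste_def image_subset_iff L0s_nat_If if_distrib cong: if_cong)

lemma AE_d_paste_eq_0:
  assumes "A \<in> sets M" "x \<in> S" "y \<in> S"
  shows "AE \<omega> in M. (\<omega> \<in> A \<longrightarrow> d x (paste A x y) \<omega> = 0) \<and> (\<omega> \<notin> A \<longrightarrow> d y (paste A x y) \<omega> = 0)"
  using d_paste[OF assms assms(2)] d_paste[OF assms assms(3)] d_self[OF assms(2)]
    d_self[OF assms(3)]
  by eventually_elim simp

lemma paste_cong:
  assumes A: "A \<in> sets M" and S: "x \<in> S" "x' \<in> S" "y \<in> S"
    and agree: "AE \<omega>\<in>A in M. d x x' \<omega> = 0"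
  shows "paste A x y = paste A x' y"
proof -
  note p = paste_in[OF A S(1,3)] and p' = paste_in[OF A S(2,3)]
  have "AE \<omega> in M. d (paste A x y) (paste A x' y) \<omega> = 0"
    using agree d_paste[OF A S(2,3) p] d_paste[OF A S(1,3) S(2)] d_paste[OF A S(1,3) S(3)]
      d_commute[OF p S(2)] d_commute[OF p S(3)] d_commute[OF S(1,2)] d_self[OF S(3)]
    by eventually_elim metis
  then show ?thesis using AE_d_eq_0_iff[OF p p'] by simp
qed

subsection \<open>Local properties\<close>

definition is_local :: "('a \<Rightarrow> 'w \<Rightarrow> bool) \<Rightarrow> bool"
  where "is_local P \<longleftrightarrow> (\<forall>x\<in>S. \<forall>y\<in>S. AE \<omega> in M. d x y \<omega> = 0 \<and> P x \<omega> \<longrightarrow> P y \<omega>)"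

lemma is_localI:
  assumes "countable C" "C \<subseteq> S"
    and P: "\<And>x y \<omega>. (\<And>c. c \<in> C \<Longrightarrow> d c x \<omega> = d c y \<omega>) \<Longrightarrow> P x \<omega> \<Longrightarrow> P y \<omega>"
  shows "is_local P"
  unfolding is_local_def
proof (intro ballI)
  fix x y assume "x \<in> S" "y \<in> S"
  then have "\<forall>c\<in>C. AE \<omega> in M. d x y \<omega> = 0 \<longrightarrow> d c x \<omega> = d c y \<omega>"
    using d_cong assms(2) by blast
  then have "AE \<omega> in M. \<forall>c\<in>C. d x y \<omega> = 0 \<longrightarrow> d c x \<omega> = d c y \<omega>"
    by (simp only: AE_ball_countable[OF assms(1)])
  then show "AE \<omega> in M. d x y \<omega> = 0 \<and> P x \<omega> \<longrightarrow> P y \<omega>"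
    by eventually_elim (metis P)
qed

lemma ex_local_choice:
  assumes P: "is_local P" "\<And>x. x \<in> U \<Longrightarrow> Measurable.pred M (P x)"
    and U: "stable_set M E U" "U \<subseteq> S" and u: "range u \<subseteq> U"
  shows "\<exists>v\<in>U. AE \<omega> in M. (\<exists>k::nat. P (u k) \<omega>) \<longrightarrow> P v \<omega>"
proof -
  have [measurable]: "Measurable.pred M (P (u k))" for k using P(2) u by blast
  define n where "n \<omega> = (LEAST k. P (u k) \<omega>)" for \<omega>
  have n: "n \<in> L0s_nat M" unfolding n_def by (rule L0s_nat_Least) measurable
  define v where "v = select u n"
  have uS: "range u \<subseteq> S" using u U(2) by blast
  have v: "v \<in> U" unfolding v_def by (rule select_in_stable_set[OF U(1) n u])
  have "AE \<omega> in M. \<forall>k. d (u k) v \<omega> = 0 \<and> P (u k) \<omega> \<longrightarrow> P v \<omega>"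
    unfolding AE_all_countable using P(1) uS v U(2) unfolding is_local_def by blast
  with AE_d_select_eq_0[OF n uS] have "AE \<omega> in M. (\<exists>k. P (u k) \<omega>) \<longrightarrow> P v \<omega>"
    unfolding v_def by eventually_elim (metis LeastI_ex n_def)
  with v show ?thesis by blast
qed

lemma ex_essentially_largest_local:
  assumes "is_local P" "\<And>x. x \<in> U \<Longrightarrow> Measurable.pred M (P x)"
    and "stable_set M E U" "U \<subseteq> S"
  shows "\<exists>u\<in>U. \<forall>v\<in>U. AE \<omega> in M. P v \<omega> \<longrightarrow> P u \<omega>"
proof (rule ex_essentially_largest)
  show "U \<noteq> {}" using assms(3) by (simp add: stable_set_def)
qed (use ex_local_choice assms in blast)+

lemma ex_local_extension:
  assumes P: "is_local P" and A: "A \<in> sets M" and y: "y \<in> S" "AE \<omega>\<in>A in M. P y \<omega>"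
    and w: "w \<in> S" "AE \<omega> in M. P w \<omega>"
  shows "\<exists>p\<in>S. (AE \<omega> in M. P p \<omega>) \<and> (AE \<omega>\<in>A in M. d y p \<omega> = 0)"
proof (intro bexI conjI)
  define p where "p = paste A y w"
  show p: "p \<in> S" unfolding p_def by (rule paste_in[OF A y(1) w(1)])
  have p_agrees: "AE \<omega> in M. (\<omega> \<in> A \<longrightarrow> d y p \<omega> = 0) \<and> (\<omega> \<notin> A \<longrightarrow> d w p \<omega> = 0)"
    unfolding p_def by (rule AE_d_paste_eq_0[OF A y(1) w(1)])
  have "AE \<omega> in M. d y p \<omega> = 0 \<and> P y \<omega> \<longrightarrow> P p \<omega>" "AE \<omega> in M. d w p \<omega> = 0 \<and> P w \<omega> \<longrightarrow> P p \<omega>"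
    using P y(1) w(1) p by (simp_all add: is_local_def)
  with p_agrees y(2) w(2) show "AE \<omega> in M. P p \<omega>" by eventually_elim blast
  show "AE \<omega>\<in>A in M. d y p \<omega> = 0" using p_agrees by eventually_elim blast
qed

lemma concat_sets_AE_local:
  assumes A: "is_partition M A"
    and P: "\<And>k. is_local (P k)"
    and nonempty: "\<And>k. \<exists>w\<in>S. AE \<omega> in M. P k w \<omega>"
    and agree: "\<And>k y. y \<in> S \<Longrightarrow> AE \<omega>\<in>A k in M. Q y \<omega> \<longleftrightarrow> P k y \<omega>"
  shows "concat_sets M E A (\<lambda>k. {y\<in>S. AE \<omega> in M. P k y \<omega>}) = {y\<in>S. AE \<omega> in M. Q y \<omega>}"
proof (intro set_eqI)
  have Ak: "A k \<in> sets M" for k using A by (simp add: is_partition_def)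
  have in_S: "{y\<in>S. AE \<omega> in M. P k y \<omega>} \<subseteq> S" for k by blast
  fix y
  show "y \<in> concat_sets M E A (\<lambda>k. {y\<in>S. AE \<omega> in M. P k y \<omega>}) \<longleftrightarrow> y \<in> {y\<in>S. AE \<omega> in M. Q y \<omega>}"
    unfolding mem_concat_sets_iff[OF A in_S]
  proof (intro iffI CollectI conjI allI; elim conjE CollectE)
    assume y: "y \<in> S" and agreeing: "\<forall>k. \<exists>w\<in>{y\<in>S. AE \<omega> in M. P k y \<omega>}. AE \<omega>\<in>A k in M. d y w \<omega> = 0"
    have "AE \<omega>\<in>A k in M. Q y \<omega>" for k
    proof -
      obtain w where w: "w \<in> S" "AE \<omega> in M. P k w \<omega>" "AE \<omega>\<in>A k in M. d y w \<omega> = 0"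
        using agreeing by blast
      have "AE \<omega> in M. d w y \<omega> = 0 \<and> P k w \<omega> \<longrightarrow> P k y \<omega>"
        using P w(1) y by (simp add: is_local_def)
      with w(2,3) agree[OF y, of k] d_commute[OF y w(1)] show ?thesis by eventually_elim simp
    qed
    then have "AE \<omega> in M. \<forall>k. \<omega> \<in> A k \<longrightarrow> Q y \<omega>" unfolding AE_all_countable ..
    with AE_space show "AE \<omega> in M. Q y \<omega>"
      by eventually_elim (use is_partition_cover[OF A] in blast)
  next
    fix k assume y: "y \<in> S" "AE \<omega> in M. Q y \<omega>"
    have "AE \<omega>\<in>A k in M. P k y \<omega>" using y(2) agree[OF y(1), of k] by eventually_elim blast
    then show "\<exists>w\<in>{y\<in>S. AE \<omega> in M. P k y \<omega>}. AE \<omega>\<in>A k in M. d y w \<omega> = 0"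
      using nonempty[of k] ex_local_extension[OF P Ak y(1)] by blast
  qed
qed

lemma stable_set_AE_local:
  assumes P: "is_local P" and nonempty: "\<exists>w\<in>S. AE \<omega> in M. P w \<omega>"
  shows "stable_set M E {y\<in>S. AE \<omega> in M. P y \<omega>}"
  unfolding stable_set_def
proof (intro conjI allI impI)
  fix A and xs :: "nat \<Rightarrow> 'a"
  assume "is_partition M A \<and> range xs \<subseteq> {y\<in>S. AE \<omega> in M. P y \<omega>}"
  then have A: "is_partition M A" and "\<forall>k. xs k \<in> {y\<in>S. AE \<omega> in M. P y \<omega>}" by blast+
  then have "concat M E A xs \<in> concat_sets M E A (\<lambda>_. {y\<in>S. AE \<omega> in M. P y \<omega>})"
    unfolding concat_sets_def by blast
  also have "\<dots> = {y\<in>S. AE \<omega> in M. P y \<omega>}"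
    by (rule concat_sets_AE_local[OF A P nonempty]) simp
  finally show "concat M E A xs \<in> {y\<in>S. AE \<omega> in M. P y \<omega>}" .
qed (use nonempty stable_set in \<open>auto simp: stable_set_def\<close>)

lemma is_local_d_less: "z \<in> S \<Longrightarrow> is_local (\<lambda>y \<omega>. d z y \<omega> < r \<omega>)"
  by (rule is_localI[of "{z}"]) auto

subsection \<open>Balls, open and closed sets\<close>

lemma mem_sball_iff: "y \<in> sball M S d x r \<longleftrightarrow> y \<in> S \<and> (AE \<omega> in M. d x y \<omega> < r \<omega>)"
  by (simp add: sball_def L0_less_def)

lemma centre_in_sball: "x \<in> S \<Longrightarrow> r \<in> L0pp M \<Longrightarrow> x \<in> sball M S d x r"
  using d_self[of x] by (auto simp: mem_sball_iff L0pp_def elim: eventually_elim2)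

lemma sopen_sball: "x \<in> S \<Longrightarrow> r \<in> L0pp M \<Longrightarrow> sopen M S d (sball M S d x r)"
  unfolding sopen_def by (auto simp: sball_def)

lemma sopen_contains_sball:
  assumes "sopen M S d V" "x \<in> V"
  obtains r where "r \<in> L0pp M" "sball M S d x r \<subseteq> V"
proof -
  obtain y q where y: "y \<in> S" "q \<in> L0pp M" "x \<in> sball M S d y q" "sball M S d y q \<subseteq> V"
    using assms unfolding sopen_def by blast
  then have x: "x \<in> S" and xy: "AE \<omega> in M. d y x \<omega> < q \<omega>" by (auto simp: mem_sball_iff)
  note [measurable] = d_measurable[OF y(1) x] y(2)
  have "(\<lambda>\<omega>. q \<omega> - d y x \<omega>) \<in> borel_measurable M" by measurable
  then have "(\<lambda>\<omega>. q \<omega> - d y x \<omega>) \<in> L0pp M"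
    using xy by (auto simp: L0pp_def L0_def)
  moreover have "sball M S d x (\<lambda>\<omega>. q \<omega> - d y x \<omega>) \<subseteq> sball M S d y q"
  proof
    fix z assume "z \<in> sball M S d x (\<lambda>\<omega>. q \<omega> - d y x \<omega>)"
    then have z: "z \<in> S" and "AE \<omega> in M. d x z \<omega> < q \<omega> - d y x \<omega>" by (auto simp: mem_sball_iff)
    from this(2) d_triangle[OF y(1) x z] have "AE \<omega> in M. d y z \<omega> < q \<omega>"
      by eventually_elim simp
    with z show "z \<in> sball M S d y q" by (simp add: mem_sball_iff)
  qed
  ultimately show ?thesis using that y(4) by blast
qed

lemma sclosedI:
  assumes "R \<subseteq> S" and "\<And>y. y \<in> S - R \<Longrightarrow> \<exists>r\<in>L0pp M. R \<inter> sball M S d y r = {}"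
  shows "sclosed M S d R"
  unfolding sclosed_def sopen_def
proof (intro conjI ballI)
  fix y assume y: "y \<in> S - R"
  then obtain r where r: "r \<in> L0pp M" "R \<inter> sball M S d y r = {}" using assms(2) by blast
  then have "y \<in> sball M S d y r" "sball M S d y r \<subseteq> S - R"
    using centre_in_sball y by (auto simp: sball_def)
  then show "\<exists>x\<in>S. \<exists>r\<in>L0pp M. y \<in> sball M S d x r \<and> sball M S d x r \<subseteq> S - R"
    using y r(1) by blast
qed (use assms(1) in auto)

lemma stable_set_meets_sball:
  assumes U: "stable_set M E U" "U \<subseteq> S" "range u \<subseteq> U" and x: "x \<in> S"
    and r: "r \<in> borel_measurable M" and near: "AE \<omega> in M. \<exists>k::nat. d x (u k) \<omega> < r \<omega>"
  shows "U \<inter> sball M S d x r \<noteq> {}"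
proof -
  have "Measurable.pred M (\<lambda>\<omega>. d x v \<omega> < r \<omega>)" if "v \<in> U" for v
    using pred_d_less[OF x _ r] U(2) that by blast
  then obtain v where v: "v \<in> U" "AE \<omega> in M. (\<exists>k. d x (u k) \<omega> < r \<omega>) \<longrightarrow> d x v \<omega> < r \<omega>"
    using ex_local_choice[OF is_local_d_less[OF x], of U r u] U by blast
  from near v(2) have "AE \<omega> in M. d x v \<omega> < r \<omega>" by eventually_elim blast
  then have "v \<in> U \<inter> sball M S d x r" using v(1) U(2) by (auto simp: mem_sball_iff)
  then show ?thesis by blast
qed

section \<open>Stable sequences\<close>

lemma stable_seq_range:
  assumes "stable_seq M E S X"
  shows "range (\<lambda>j. X (\<lambda>_. j)) \<subseteq> S"
  using assms L0s_nat_const by (auto simp: stable_seq_def)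

lemma stable_seq_eq_select:
  assumes X: "stable_seq M E S X" and n: "n \<in> L0s_nat M"
  shows "X n = select (\<lambda>j. X (\<lambda>_. j)) n"
proof -
  have "is_nat_concat M (\<lambda>j. {\<omega> \<in> space M. n \<omega> = j}) (\<lambda>j _. j) n"
    by (auto simp: is_nat_concat_def)
  moreover have "range (\<lambda>j _. j) \<subseteq> L0s_nat M" using L0s_nat_const by blast
  ultimately show ?thesis
    using X is_partition_level_sets[OF n] n unfolding stable_seq_def select_def by blast
qed

lemma stable_seq_select:
  assumes xs: "range xs \<subseteq> S"
  shows "stable_seq M E S (select xs)"
  unfolding stable_seq_def
proof (intro conjI ballI allI impI; (elim conjE)?)
  show "select xs n \<in> S" if "n \<in> L0s_nat M" for n by (rule select_in[OF that xs])
next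
  fix A ns m
  assume A: "is_partition M A" and ns: "range ns \<subseteq> L0s_nat M" and m: "m \<in> L0s_nat M"
    and m_eq: "is_nat_concat M A ns m"
  have ns: "ns k \<in> L0s_nat M" for k using ns by blast
  have sS: "range (\<lambda>k. select xs (ns k)) \<subseteq> S" using select_in[OF ns xs] by blast
  have "AE \<omega>\<in>A k in M. d (select xs m) (select xs (ns k)) \<omega> = 0" for k
  proof -
    have "AE \<omega>\<in>A k in M. m \<omega> = ns k \<omega>" using m_eq by (simp add: is_nat_concat_def)
    with d_select_left[OF m xs select_in[OF ns xs], of k] AE_d_select_eq_0[OF ns xs, of k]
    show ?thesis by eventually_elim simp
  qed
  then show "select xs m = concat M E A (\<lambda>k. select xs (ns k))"
    using concat_eq_iff[OF A sS select_in[OF m xs]] by simp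
qed

lemma stable_seq_comp:
  assumes X: "stable_seq M E S X" and N: "subseq_index M N"
  shows "stable_seq M E S (X \<circ> N)"
  unfolding stable_seq_def comp_def
proof (intro conjI ballI allI impI; (elim conjE)?)
  show "X (N n) \<in> S" if "n \<in> L0s_nat M" for n
    using X N that by (simp add: stable_seq_def subseq_index_def)
next
  fix A ns m
  assume "is_partition M A" "range ns \<subseteq> L0s_nat M" "m \<in> L0s_nat M" "is_nat_concat M A ns m"
  moreover from this N have "is_nat_concat M A (\<lambda>k. N (ns k)) (N m)" "N m \<in> L0s_nat M"
    "range (\<lambda>k. N (ns k)) \<subseteq> L0s_nat M" by (auto simp: subseq_index_def)
  ultimately show "X (N m) = concat M E A (\<lambda>k. X (N (ns k)))"
    using X unfolding stable_seq_def by blast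
qed

definition AE_converges :: "(nat \<Rightarrow> 'a) \<Rightarrow> 'a \<Rightarrow> bool"
  where "AE_converges x y \<longleftrightarrow>
    (AE \<omega> in M. \<forall>e>0. \<forall>\<^sub>F j in sequentially. d (x j) y \<omega> < e)"

definition AE_clusters :: "(nat \<Rightarrow> 'a) \<Rightarrow> 'a \<Rightarrow> bool"
  where "AE_clusters x y \<longleftrightarrow>
    (AE \<omega> in M. \<forall>e>0. \<exists>\<^sub>F j in sequentially. d (x j) y \<omega> < e)"

definition AE_Cauchy :: "(nat \<Rightarrow> 'a) \<Rightarrow> bool"
  where "AE_Cauchy x \<longleftrightarrow> (AE \<omega> in M. \<forall>e>0. \<exists>N. \<forall>i\<ge>N. \<forall>j\<ge>N. d (x i) (x j) \<omega> \<le> e)"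

lemma AE_converges_if_less_inverse_Suc:
  assumes "AE \<omega> in M. \<forall>k. d (x k) y \<omega> < inverse (real (Suc k))"
  shows "AE_converges x y"
  unfolding AE_converges_def using assms
proof eventually_elim
  case (elim \<omega>)
  show ?case
  proof (intro allI impI)
    fix e :: real assume "e > 0"
    with LIMSEQ_inverse_real_of_nat have "\<forall>\<^sub>F k in sequentially. inverse (real (Suc k)) < e"
      by (rule order_tendstoD(2))
    then show "\<forall>\<^sub>F k in sequentially. d (x k) y \<omega> < e"
      using elim by (auto elim!: eventually_mono intro: less_trans)
  qed
qed

lemma AE_Cauchy_if_less_inverse_Suc:
  assumes "\<And>i j. AE \<omega> in M. d (y i) (y j) \<omega> < inverse (real (Suc i)) + inverse (real (Suc j))"
  shows "AE_Cauchy y"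
proof -
  have "AE \<omega> in M. \<forall>i j. d (y i) (y j) \<omega> < inverse (real (Suc i)) + inverse (real (Suc j))"
    unfolding AE_all_countable using assms by blast
  then show ?thesis
    unfolding AE_Cauchy_def
  proof eventually_elim
    case (elim \<omega>)
    show ?case
    proof (intro allI impI)
      fix e :: real assume "e > 0"
      then obtain N where N: "inverse (real (Suc N)) < e / 2"
        using reals_Archimedean half_gt_zero by blast
      have "d (y i) (y j) \<omega> \<le> e" if "i \<ge> N" "j \<ge> N" for i j
      proof -
        have "inverse (real (Suc i)) \<le> inverse (real (Suc N))"
          "inverse (real (Suc j)) \<le> inverse (real (Suc N))"
          using that by (simp_all add: le_imp_inverse_le)
        then show ?thesis using N elim by (smt (verit) field_sum_of_halves)
      qed
      then show "\<exists>N. \<forall>i\<ge>N. \<forall>j\<ge>N. d (y i) (y j) \<omega> \<le> e" by blast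
    qed
  qed
qed

lemma sconverges_iff_AE_converges:
  assumes X: "stable_seq M E S X" and y: "y \<in> S"
  shows "sconverges M d X y \<longleftrightarrow> AE_converges (\<lambda>j. X (\<lambda>_. j)) y"
proof -
  define x where "x = (\<lambda>j. X (\<lambda>_. j))"
  have x: "range x \<subseteq> S" unfolding x_def by (rule stable_seq_range[OF X])
  have [measurable]: "d (x j) y \<in> borel_measurable M" for j using d_measurable x y by blast
  have agree: "L0_less M (d (X n) y) r \<longleftrightarrow> (AE \<omega> in M. d (x (n \<omega>)) y \<omega> < r \<omega>)"
    if "n \<in> L0s_nat M" for n r
  proof -
    have "X n = select x n" unfolding x_def by (rule stable_seq_eq_select[OF X that])
    then show ?thesis
      unfolding L0_less_def using d_select_left[OF that x y]
      by (intro eventually_subst) (auto elim: eventually_mono)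
  qed
  have "(\<exists>n0\<in>L0s_nat M. \<forall>n\<in>L0s_nat M. nat_le M n0 n \<longrightarrow> L0_less M (d (X n) y) r) \<longleftrightarrow>
      (AE \<omega> in M. \<forall>\<^sub>F j in sequentially. d (x j) y \<omega> < r \<omega>)" if [measurable]: "r \<in> L0pp M" for r
  proof -
    have "(\<exists>n0\<in>L0s_nat M. \<forall>n\<in>L0s_nat M. nat_le M n0 n \<longrightarrow> (AE \<omega> in M. d (x (n \<omega>)) y \<omega> < r \<omega>)) \<longleftrightarrow>
        (AE \<omega> in M. \<forall>\<^sub>F j in sequentially. d (x j) y \<omega> < r \<omega>)"
      by (rule ex_L0s_nat_tail_iff_eventually) measurable
    then show ?thesis by (simp add: agree cong: ball_cong)
  qed
  then have "sconverges M d X y \<longleftrightarrow>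
      (\<forall>r\<in>L0pp M. AE \<omega> in M. \<forall>\<^sub>F j in sequentially. d (x j) y \<omega> < r \<omega>)"
    unfolding sconverges_def by (rule ball_cong[OF refl])
  also have "\<dots> \<longleftrightarrow> AE_converges x y"
    unfolding AE_converges_def by (rule all_L0pp_AE_iff) (auto elim!: eventually_mono)
  finally show ?thesis unfolding x_def .
qed

lemma scauchy_iff_AE_Cauchy:
  assumes X: "stable_seq M E S X"
  shows "scauchy M d X \<longleftrightarrow> AE_Cauchy (\<lambda>j. X (\<lambda>_. j))"
proof -
  define x where "x = (\<lambda>j. X (\<lambda>_. j))"
  have x: "range x \<subseteq> S" unfolding x_def by (rule stable_seq_range[OF X])
  have [measurable]: "d (x i) (x j) \<in> borel_measurable M" for i j using d_measurable x by blast
  have agree: "L0_le M (d (X n) (X m)) r \<longleftrightarrow> (AE \<omega> in M. d (x (n \<omega>)) (x (m \<omega>)) \<omega> \<le> r \<omega>)"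
    if "n \<in> L0s_nat M" "m \<in> L0s_nat M" for n m r
  proof -
    have "X n = select x n" "X m = select x m"
      unfolding x_def using stable_seq_eq_select[OF X] that by blast+
    then show ?thesis
      unfolding L0_le_def using d_select_select[OF that x x]
      by (intro eventually_subst) (auto elim: eventually_mono)
  qed
  have "(\<exists>n0\<in>L0s_nat M. \<forall>n\<in>L0s_nat M. \<forall>m\<in>L0s_nat M. nat_le M n0 n \<and> nat_le M n0 m \<longrightarrow>
      L0_le M (d (X n) (X m)) r) \<longleftrightarrow>
      (AE \<omega> in M. \<exists>N. \<forall>i\<ge>N. \<forall>j\<ge>N. d (x i) (x j) \<omega> \<le> r \<omega>)" if [measurable]: "r \<in> L0pp M" for r
  proof -
    have "(\<exists>n0\<in>L0s_nat M. \<forall>n\<in>L0s_nat M. \<forall>m\<in>L0s_nat M. nat_le M n0 n \<and> nat_le M n0 m \<longrightarrow>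
        (AE \<omega> in M. d (x (n \<omega>)) (x (m \<omega>)) \<omega> \<le> r \<omega>)) \<longleftrightarrow>
        (AE \<omega> in M. \<exists>N. \<forall>i\<ge>N. \<forall>j\<ge>N. d (x i) (x j) \<omega> \<le> r \<omega>)"
      by (rule ex_L0s_nat_tail_iff) measurable
    then show ?thesis by (simp add: agree cong: ball_cong)
  qed
  then have "scauchy M d X \<longleftrightarrow> (\<forall>r\<in>L0pp M. AE \<omega> in M. \<exists>N. \<forall>i\<ge>N. \<forall>j\<ge>N. d (x i) (x j) \<omega> \<le> r \<omega>)"
    unfolding scauchy_def by (rule ball_cong[OF refl])
  also have "\<dots> \<longleftrightarrow> AE_Cauchy x"
    unfolding AE_Cauchy_def by (rule all_L0pp_AE_iff) (meson order_trans)
  finally show ?thesis unfolding x_def .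
qed

lemma stable_complete_iff:
  "stable_complete M E S d \<longleftrightarrow>
    (\<forall>x. range x \<subseteq> S \<and> AE_Cauchy x \<longrightarrow> (\<exists>y\<in>S. AE_converges x y))"
proof
  assume complete: "stable_complete M E S d"
  show "\<forall>x. range x \<subseteq> S \<and> AE_Cauchy x \<longrightarrow> (\<exists>y\<in>S. AE_converges x y)"
  proof (intro allI impI, elim conjE)
    fix x assume x: "range x \<subseteq> S" "AE_Cauchy x"
    note X = stable_seq_select[OF x(1)]
    have "scauchy M d (select x)"
      using x by (simp add: scauchy_iff_AE_Cauchy[OF X] select_const)
    then obtain y where "y \<in> S" "sconverges M d (select x) y"
      using complete X unfolding stable_complete_def by blast
    then show "\<exists>y\<in>S. AE_converges x y"
      using sconverges_iff_AE_converges[OF X] by (auto simp: select_const[OF x(1)])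
  qed
next
  assume limits: "\<forall>x. range x \<subseteq> S \<and> AE_Cauchy x \<longrightarrow> (\<exists>y\<in>S. AE_converges x y)"
  show "stable_complete M E S d"
    unfolding stable_complete_def
  proof (intro allI impI, elim conjE)
    fix X assume X: "stable_seq M E S X" "scauchy M d X"
    then show "\<exists>y\<in>S. sconverges M d X y"
      using limits stable_seq_range[OF X(1)] scauchy_iff_AE_Cauchy sconverges_iff_AE_converges
      by blast
  qed
qed

lemma subseq_indexI:
  assumes t: "\<And>k. t k \<in> L0s_nat M" and mono: "AE \<omega> in M. strict_mono (\<lambda>k. t k \<omega>)"
  shows "subseq_index M (\<lambda>k \<omega>. t (k \<omega>) \<omega>)"
  unfolding subseq_index_def
proof (intro conjI ballI allI impI; (elim conjE)?)
  show "(\<lambda>\<omega>. t (k \<omega>) \<omega>) \<in> L0s_nat M" if "k \<in> L0s_nat M" for k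
    by (rule L0s_nat_compose[OF t that])
next
  fix A ks m assume "is_nat_concat M A ks m"
  then show "is_nat_concat M A (\<lambda>j \<omega>. t (ks j \<omega>) \<omega>) (\<lambda>\<omega>. t (m \<omega>) \<omega>)"
    unfolding is_nat_concat_def by (auto elim!: eventually_mono)
next
  fix k k' assume "nat_less M k k'"
  with mono show "nat_less M (\<lambda>\<omega>. t (k \<omega>) \<omega>) (\<lambda>\<omega>. t (k' \<omega>) \<omega>)"
    unfolding nat_less_def by eventually_elim (rule strict_monoD[where f = "\<lambda>j. t j _"])
qed

lemma subseq_index_strict_mono:
  assumes N: "subseq_index M N"
  shows "AE \<omega> in M. strict_mono (\<lambda>j. N (\<lambda>_. j) \<omega>)"
proof -
  have "nat_less M (\<lambda>_. j) (\<lambda>_. Suc j)" for j by (simp add: nat_less_def)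
  then have "nat_less M (N (\<lambda>_. j)) (N (\<lambda>_. Suc j))" for j
    using N L0s_nat_const[of _ M] unfolding subseq_index_def by blast
  then have "AE \<omega> in M. \<forall>j. N (\<lambda>_. j) \<omega> < N (\<lambda>_. Suc j) \<omega>"
    unfolding nat_less_def AE_all_countable ..
  then show ?thesis by eventually_elim (simp add: strict_mono_Suc_iff)
qed

lemma AE_clusters_if_sconverges_subseq:
  assumes X: "stable_seq M E S X" and N: "subseq_index M N" and y: "y \<in> S"
    and converges: "sconverges M d (X \<circ> N) y"
  shows "AE_clusters (\<lambda>j. X (\<lambda>_. j)) y"
proof -
  define x where "x = (\<lambda>j. X (\<lambda>_. j))"
  define t where "t k = N (\<lambda>_. k)" for k
  have x: "range x \<subseteq> S" using stable_seq_range[OF X] by (simp add: x_def)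
  have t: "t k \<in> L0s_nat M" for k using N L0s_nat_const by (auto simp: t_def subseq_index_def)
  have "AE_converges (\<lambda>k. select x (t k)) y"
    using sconverges_iff_AE_converges[OF stable_seq_comp[OF X N] y] converges
    by (simp add: t_def x_def stable_seq_eq_select[OF X t[unfolded t_def]])
  moreover have "AE \<omega> in M. \<forall>k. d (select x (t k)) y \<omega> = d (x (t k \<omega>)) y \<omega>"
    unfolding AE_all_countable using d_select_left[OF t x y] ..
  moreover have "AE \<omega> in M. strict_mono (\<lambda>k. t k \<omega>)"
    using subseq_index_strict_mono[OF N] by (simp add: t_def)
  ultimately have "AE_clusters x y"
    unfolding AE_converges_def AE_clusters_def
  proof eventually_elim
    case (elim \<omega>)
    show ?case
    proof (intro allI impI, rule ccontr)
      fix e :: real assume "e > 0" and "\<not> (\<exists>\<^sub>F j in sequentially. d (x j) y \<omega> < e)"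
      then have far: "\<forall>\<^sub>F j in sequentially. \<not> d (x j) y \<omega> < e" by (simp add: not_frequently)
      have "\<forall>\<^sub>F k in sequentially. \<not> d (x (t k \<omega>)) y \<omega> < e"
        by (rule eventually_compose_filterlim[OF far filterlim_subseq[OF elim(3)]])
      moreover have "\<forall>\<^sub>F k in sequentially. d (x (t k \<omega>)) y \<omega> < e"
        using elim(1,2) \<open>e > 0\<close> by simp
      ultimately have "\<forall>\<^sub>F k::nat in sequentially. False" by eventually_elim simp
      then show False by simp
    qed
  qed
  then show ?thesis by (simp add: x_def)
qed

lemma ex_sconverges_subseq_if_AE_clusters:
  assumes X: "stable_seq M E S X" and y: "y \<in> S" and cluster: "AE_clusters (\<lambda>j. X (\<lambda>_. j)) y"
  shows "\<exists>N. subseq_index M N \<and> sconverges M d (X \<circ> N) y"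
proof -
  define x where "x = (\<lambda>j. X (\<lambda>_. j))"
  have x: "range x \<subseteq> S" using stable_seq_range[OF X] by (simp add: x_def)
  have [measurable]: "d (x j) y \<in> borel_measurable M" for j using d_measurable x y by blast
  have "AE \<omega> in M. \<forall>k. \<exists>\<^sub>F j in sequentially. d (x j) y \<omega> < inverse (real (Suc k))"
    using cluster unfolding AE_clusters_def x_def by eventually_elim simp
  then have "\<exists>t. (\<forall>k. t k \<in> L0s_nat M) \<and>
      (AE \<omega> in M. strict_mono (\<lambda>k. t k \<omega>) \<and> (\<forall>k. d (x (t k \<omega>)) y \<omega> < inverse (real (Suc k))))"
    by (rule ex_random_subseq[rotated]) measurable
  then obtain t where t: "\<And>k. t k \<in> L0s_nat M" and "AE \<omega> in M. strict_mono (\<lambda>k. t k \<omega>) \<and>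
      (\<forall>k. d (x (t k \<omega>)) y \<omega> < inverse (real (Suc k)))" by blast
  then have mono: "AE \<omega> in M. strict_mono (\<lambda>k. t k \<omega>)"
    and close: "AE \<omega> in M. \<forall>k. d (x (t k \<omega>)) y \<omega> < inverse (real (Suc k))"
    by (auto elim: eventually_mono)
  define N where "N k \<omega> = t (k \<omega>) \<omega>" for k \<omega>
  have N: "subseq_index M N" unfolding N_def[abs_def] by (rule subseq_indexI[OF t mono])
  have "AE \<omega> in M. \<forall>k. d (X (t k)) y \<omega> = d (x (t k \<omega>)) y \<omega>"
    unfolding AE_all_countable stable_seq_eq_select[OF X t]
    using d_select_left[OF t x y] by (simp add: x_def)
  with close have "AE \<omega> in M. \<forall>k. d (X (t k)) y \<omega> < inverse (real (Suc k))"
    by eventually_elim simp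
  then have "AE_converges (\<lambda>k. X (t k)) y" by (rule AE_converges_if_less_inverse_Suc)
  then have "sconverges M d (X \<circ> N) y"
    using sconverges_iff_AE_converges[OF stable_seq_comp[OF X N] y] by (simp add: N_def[abs_def])
  with N show ?thesis by blast
qed

lemma stable_seq_compact_iff:
  "stable_seq_compact M E S d \<longleftrightarrow> (\<forall>x. range x \<subseteq> S \<longrightarrow> (\<exists>y\<in>S. AE_clusters x y))"
proof
  assume compact: "stable_seq_compact M E S d"
  show "\<forall>x. range x \<subseteq> S \<longrightarrow> (\<exists>y\<in>S. AE_clusters x y)"
  proof (intro allI impI)
    fix x :: "nat \<Rightarrow> 'a" assume x: "range x \<subseteq> S"
    note X = stable_seq_select[OF x]
    then obtain N y where "subseq_index M N" "y \<in> S" "sconverges M d (select x \<circ> N) y"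
      using compact unfolding stable_seq_compact_def by blast
    then show "\<exists>y\<in>S. AE_clusters x y"
      using AE_clusters_if_sconverges_subseq[OF X] by (auto simp: select_const[OF x])
  qed
next
  assume clusters: "\<forall>x. range x \<subseteq> S \<longrightarrow> (\<exists>y\<in>S. AE_clusters x y)"
  show "stable_seq_compact M E S d"
    unfolding stable_seq_compact_def
  proof (intro allI impI)
    fix X assume X: "stable_seq M E S X"
    then obtain y where "y \<in> S" "AE_clusters (\<lambda>j. X (\<lambda>_. j)) y"
      using clusters stable_seq_range by meson
    then show "\<exists>N. subseq_index M N \<and> (\<exists>x\<in>S. sconverges M d (X \<circ> N) x)"
      using ex_sconverges_subseq_if_AE_clusters[OF X] by blast
  qed
qed

section \<open>Nested closed sets give cluster points\<close>

definition tail_closure :: "(nat \<Rightarrow> 'a) \<Rightarrow> ('w \<Rightarrow> nat) \<Rightarrow> 'a set"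
  where "tail_closure x n = {y\<in>S. AE \<omega> in M. \<forall>e>0. \<exists>j\<ge>n \<omega>. d (x j) y \<omega> < e}"

lemma is_local_near_tail:
  fixes x :: "nat \<Rightarrow> 'a"
  assumes "range x \<subseteq> S"
  shows "is_local (\<lambda>y \<omega>. \<forall>e>0. \<exists>j\<ge>n \<omega>. d (x j) y \<omega> < e)"
  using assms by (intro is_localI[of "range x"]) auto

lemma select_in_tail_closure:
  assumes n: "n \<in> L0s_nat M" and x: "range x \<subseteq> S"
  shows "select x n \<in> tail_closure x n"
proof -
  have "AE \<omega> in M. \<forall>e>0. \<exists>j\<ge>n \<omega>. d (x j) (select x n) \<omega> < e"
    using AE_d_select_eq_0[OF n x] by eventually_elim (metis order_refl)
  then show ?thesis using select_in[OF n x] by (simp add: tail_closure_def)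
qed

lemma stable_set_tail_closure:
  assumes n: "n \<in> L0s_nat M" and x: "range x \<subseteq> S"
  shows "stable_set M E (tail_closure x n)"
  unfolding tail_closure_def using select_in_tail_closure[OF assms]
  by (intro stable_set_AE_local is_local_near_tail x) (auto simp: tail_closure_def)

lemma stable_set_seq_tail_closure:
  assumes x: "range x \<subseteq> S"
  shows "stable_set_seq M E (tail_closure x)"
  unfolding stable_set_seq_def
proof (intro allI impI, elim conjE)
  fix A ns m
  assume A: "is_partition M A" and ns: "range ns \<subseteq> L0s_nat M" and m_eq: "is_nat_concat M A ns m"
  show "tail_closure x m = concat_sets M E A (\<lambda>k. tail_closure x (ns k))"
    unfolding tail_closure_def
  proof (rule concat_sets_AE_local[symmetric, OF A])
    show "is_local (\<lambda>y \<omega>. \<forall>e>0. \<exists>j\<ge>ns k \<omega>. d (x j) y \<omega> < e)" for k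
      by (rule is_local_near_tail[OF x])
    show "\<exists>w\<in>S. AE \<omega> in M. \<forall>e>0. \<exists>j\<ge>ns k \<omega>. d (x j) w \<omega> < e" for k
      using select_in_tail_closure[of "ns k", OF _ x] ns by (auto simp: tail_closure_def)
    show "AE \<omega>\<in>A k in M. (\<forall>e>0. \<exists>j\<ge>m \<omega>. d (x j) y \<omega> < e) \<longleftrightarrow> (\<forall>e>0. \<exists>j\<ge>ns k \<omega>. d (x j) y \<omega> < e)"
      for k y
      using m_eq unfolding is_nat_concat_def by (auto elim!: eventually_mono)
  qed
qed

lemma sclosed_tail_closure:
  assumes x: "range x \<subseteq> S"
  shows "sclosed M S d (tail_closure x n)"
proof (rule sclosedI)
  fix y assume y: "y \<in> S - tail_closure x n"
  have "\<not> (\<forall>r\<in>L0pp M. AE \<omega> in M. \<exists>j\<ge>n \<omega>. d (x j) y \<omega> < r \<omega>)"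
    using y all_L0pp_AE_iff[where M = M and P = "\<lambda>e \<omega>. \<exists>j\<ge>n \<omega>. d (x j) y \<omega> < e"]
    by (force simp: tail_closure_def)
  then obtain r where r: "r \<in> L0pp M" and far: "\<not> (AE \<omega> in M. \<exists>j\<ge>n \<omega>. d (x j) y \<omega> < r \<omega>)"
    by blast
  have "z \<notin> tail_closure x n" if z: "z \<in> sball M S d y (\<lambda>\<omega>. r \<omega> / 2)" for z
  proof
    assume "z \<in> tail_closure x n"
    then have near: "AE \<omega> in M. \<forall>e>0. \<exists>j\<ge>n \<omega>. d (x j) z \<omega> < e" by (simp add: tail_closure_def)
    have zS: "z \<in> S" and close: "AE \<omega> in M. d y z \<omega> < r \<omega> / 2"
      using z by (simp_all add: mem_sball_iff)
    have triangle: "AE \<omega> in M. \<forall>j. d (x j) y \<omega> \<le> d (x j) z \<omega> + d y z \<omega>"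
      unfolding AE_all_countable using d_triangle2 x y zS by blast
    have "AE \<omega> in M. 0 < r \<omega>" by (rule L0pp_pos[OF r])
    with near close triangle have "AE \<omega> in M. \<exists>j\<ge>n \<omega>. d (x j) y \<omega> < r \<omega>"
    proof eventually_elim
      case (elim \<omega>)
      then obtain j where "j \<ge> n \<omega>" "d (x j) z \<omega> < r \<omega> / 2" by (metis half_gt_zero)
      with elim show ?case by (intro exI[of _ j]) (smt (verit) field_sum_of_halves)
    qed
    with far show False ..
  qed
  then show "\<exists>r\<in>L0pp M. tail_closure x n \<inter> sball M S d y r = {}"
    using L0pp_half[OF r] by blast
qed (auto simp: tail_closure_def)

lemma tail_closure_antimono:
  assumes "nat_le M n m"
  shows "tail_closure x m \<subseteq> tail_closure x n"
proof
  fix y assume y: "y \<in> tail_closure x m"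
  then have "AE \<omega> in M. \<forall>e>0. \<exists>j\<ge>m \<omega>. d (x j) y \<omega> < e" by (simp add: tail_closure_def)
  with assms have "AE \<omega> in M. \<forall>e>0. \<exists>j\<ge>n \<omega>. d (x j) y \<omega> < e"
    unfolding nat_le_def by eventually_elim (meson order_trans)
  with y show "y \<in> tail_closure x n" by (simp add: tail_closure_def)
qed

lemma AE_clusters_if_in_all_tail_closures:
  assumes "\<And>k. y \<in> tail_closure x (\<lambda>_. k)"
  shows "AE_clusters x y"
proof -
  have "AE \<omega> in M. \<forall>k. \<forall>e>0. \<exists>j\<ge>k. d (x j) y \<omega> < e"
    unfolding AE_all_countable[where P = "\<lambda>k \<omega>. \<forall>e>0. Q k e \<omega>" for Q]
    using assms by (simp add: tail_closure_def)
  then show ?thesis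
    unfolding AE_clusters_def frequently_sequentially by eventually_elim blast
qed

lemma stable_seq_compact_if_decreasing_closed_property:
  assumes "decreasing_closed_property M E S d"
  shows "stable_seq_compact M E S d"
  unfolding stable_seq_compact_iff
proof (intro allI impI)
  fix x :: "nat \<Rightarrow> 'a" assume x: "range x \<subseteq> S"
  have "(\<Inter>n\<in>L0s_nat M. tail_closure x n) \<noteq> {}"
    by (rule assms[unfolded decreasing_closed_property_def, rule_format])
      (simp add: x stable_set_seq_tail_closure stable_set_tail_closure sclosed_tail_closure
        tail_closure_antimono)
  then obtain y where y: "y \<in> tail_closure x (\<lambda>_. k)" for k
    using L0s_nat_const by blast
  then have "y \<in> S" by (simp add: tail_closure_def)
  with y AE_clusters_if_in_all_tail_closures show "\<exists>y\<in>S. AE_clusters x y" by blast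
qed

section \<open>Sequential compactness implies completeness and total boundedness\<close>

lemma AE_converges_if_AE_Cauchy_AE_clusters:
  assumes x: "range x \<subseteq> S" and y: "y \<in> S" and Cauchy: "AE_Cauchy x" and cluster: "AE_clusters x y"
  shows "AE_converges x y"
proof -
  have "AE \<omega> in M. \<forall>i j. d (x i) y \<omega> \<le> d (x i) (x j) \<omega> + d (x j) y \<omega>"
    unfolding AE_all_countable using d_triangle x y by blast
  with Cauchy cluster show ?thesis
    unfolding AE_Cauchy_def AE_clusters_def AE_converges_def
  proof eventually_elim
    case (elim \<omega>)
    show ?case
    proof (intro allI impI)
      fix e :: real assume "e > 0"
      then obtain N where N: "\<forall>i\<ge>N. \<forall>j\<ge>N. d (x i) (x j) \<omega> \<le> e / 2"
        using elim(1) half_gt_zero by blast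
      obtain j where j: "j \<ge> N" "d (x j) y \<omega> < e / 2"
        using elim(2) \<open>e > 0\<close> by (meson frequently_sequentially half_gt_zero)
      have "d (x i) y \<omega> < e" if "i \<ge> N" for i
        using N elim(3) j that by (smt (verit) field_sum_of_halves)
      then show "\<forall>\<^sub>F i in sequentially. d (x i) y \<omega> < e"
        by (auto simp: eventually_sequentially)
    qed
  qed
qed

lemma stable_complete_if_stable_seq_compact:
  "stable_seq_compact M E S d \<Longrightarrow> stable_complete M E S d"
  unfolding stable_seq_compact_iff stable_complete_iff
  using AE_converges_if_AE_Cauchy_AE_clusters by meson

text \<open>Only the first \<open>m \<omega>\<close> centres are needed at \<open>\<omega>\<close>; this is what stable finiteness of a net
  amounts to.\<close>

definition random_net :: "('w \<Rightarrow> real) \<Rightarrow> (nat \<Rightarrow> 'a) \<Rightarrow> ('w \<Rightarrow> nat) \<Rightarrow> bool"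
  where "random_net r z m \<longleftrightarrow> range z \<subseteq> S \<and> m \<in> L0s_nat M \<and>
    (\<forall>u\<in>S. AE \<omega> in M. \<exists>i<m \<omega>. d (z i) u \<omega> < r \<omega>)"

lemma stable_hull_subset: "X \<subseteq> S \<Longrightarrow> stable_hull M E X \<subseteq> S"
  unfolding stable_hull_def using concat_in by blast

lemma ex_stable_finite_select:
  assumes z: "range z \<subseteq> S" and m: "m \<in> L0s_nat M"
  shows "\<exists>N. stable_finite M E S N \<and>
    (\<forall>i\<in>L0s_nat M. nat_le M i m \<longrightarrow> select z i \<in> N)"
proof (intro exI conjI ballI impI)
  define A where "A j = {\<omega>\<in>space M. m \<omega> = j}" for j
  have A: "is_partition M A" using is_partition_level_sets[OF m] by (simp add: A_def[abs_def])
  define N where "N = concat_sets M E A (\<lambda>j. stable_hull M E (z ` {..j}))"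
  show "stable_finite M E S N"
    unfolding stable_finite_def using A z
    by (intro exI[of _ A] exI[of _ "\<lambda>j. z ` {..j}"]) (auto simp: N_def)
  have hull: "stable_hull M E (z ` {..j}) \<subseteq> S" for j
    using z by (intro stable_hull_subset) auto
  fix i assume i: "i \<in> L0s_nat M" "nat_le M i m"
  show "select z i \<in> N"
    unfolding N_def mem_concat_sets_iff[OF A hull]
  proof (intro conjI allI)
    show sel: "select z i \<in> S" by (rule select_in[OF i(1) z])
    fix j
    have range: "range (\<lambda>i. z (min i j)) \<subseteq> z ` {..j}" by auto
    then have "select (\<lambda>i. z (min i j)) i \<in> stable_hull M E (z ` {..j})"
      unfolding stable_hull_def select_def using is_partition_level_sets[OF i(1)] by blast
    moreover have rangeS: "range (\<lambda>i. z (min i j)) \<subseteq> S" using range z by blast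
    have "AE \<omega>\<in>A j in M. d (select z i) (select (\<lambda>i. z (min i j)) i) \<omega> = 0"
      using d_select_right[OF i(1) rangeS sel] d_select_right[OF i(1) z sel] d_self[OF sel]
        i(2)[unfolded nat_le_def]
      by eventually_elim (simp add: A_def)
    ultimately show "\<exists>w\<in>stable_hull M E (z ` {..j}). AE \<omega>\<in>A j in M. d (select z i) w \<omega> = 0"
      by blast
  qed
qed

lemma stable_finite_cover_if_random_net:
  assumes net: "random_net r z m" and [measurable]: "r \<in> borel_measurable M"
  shows "\<exists>N. stable_finite M E S N \<and> S = (\<Union>x\<in>N. sball M S d x r)"
proof -
  have z: "range z \<subseteq> S" and m: "m \<in> L0s_nat M" using net by (simp_all add: random_net_def)
  obtain N where N: "stable_finite M E S N"
    and sel: "\<And>i. i \<in> L0s_nat M \<Longrightarrow> nat_le M i m \<Longrightarrow> select z i \<in> N"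
    using ex_stable_finite_select[OF z m] by blast
  have "u \<in> (\<Union>x\<in>N. sball M S d x r)" if u: "u \<in> S" for u
  proof -
    have [measurable]: "d (z i) u \<in> borel_measurable M" for i using d_measurable z u by blast
    define i where "i \<omega> = (LEAST i. d (z i) u \<omega> < r \<omega>)" for \<omega>
    have i: "i \<in> L0s_nat M" unfolding i_def by (rule L0s_nat_Least) measurable
    have "AE \<omega> in M. \<exists>i<m \<omega>. d (z i) u \<omega> < r \<omega>" using net u by (simp add: random_net_def)
    then have i_net: "AE \<omega> in M. i \<omega> \<le> m \<omega> \<and> d (z (i \<omega>)) u \<omega> < r \<omega>"
    proof eventually_elim
      case (elim \<omega>)
      then obtain l where l: "l < m \<omega>" "d (z l) u \<omega> < r \<omega>" by blast
      have "i \<omega> \<le> l" unfolding i_def using l(2) by (rule Least_le)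
      moreover have "d (z (i \<omega>)) u \<omega> < r \<omega>" unfolding i_def using l(2) by (rule LeastI)
      ultimately show ?case using l(1) by simp
    qed
    then have "select z i \<in> N" by (intro sel[OF i]) (auto simp: nat_le_def elim: eventually_mono)
    moreover have "AE \<omega> in M. d (select z i) u \<omega> < r \<omega>"
      using d_select_left[OF i z u] i_net by eventually_elim simp
    ultimately show ?thesis using u by (auto simp: mem_sball_iff)
  qed
  then have "S = (\<Union>x\<in>N. sball M S d x r)" by (auto simp: sball_def)
  with N show ?thesis by blast
qed

lemma AE_d_stable_hull:
  assumes y: "y \<in> stable_hull M E X" and X: "X \<subseteq> S" and u: "u \<in> S"
  shows "AE \<omega> in M. \<exists>x\<in>X. d y u \<omega> = d x u \<omega>"
proof -
  obtain A xs where A: "is_partition M A" and xs: "range xs \<subseteq> X" and "y = concat M E A xs"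
    using y unfolding stable_hull_def by blast
  then have "AE \<omega> in M. \<forall>k. \<omega> \<in> A k \<longrightarrow> d y u \<omega> = d (xs k) u \<omega>"
    using d_concat_left[OF A _ u] X by blast
  with AE_space show ?thesis
    by eventually_elim (use is_partition_cover[OF A] xs in blast)
qed

lemma AE_d_concat_sets_stable_hull:
  assumes A: "is_partition M A" and X: "\<And>k. X k \<subseteq> S" and u: "u \<in> S"
    and w: "w \<in> concat_sets M E A (\<lambda>k. stable_hull M E (X k))"
  shows "AE \<omega> in M. \<forall>k. \<omega> \<in> A k \<longrightarrow> (\<exists>x\<in>X k. d w u \<omega> = d x u \<omega>)"
proof -
  obtain ys where ys: "w = concat M E A ys" "\<And>k. ys k \<in> stable_hull M E (X k)"
    using w by (auto simp: concat_sets_def)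
  have ysS: "range ys \<subseteq> S" using ys(2) stable_hull_subset[OF X] by blast
  have "AE \<omega> in M. \<forall>k. \<exists>x\<in>X k. d (ys k) u \<omega> = d x u \<omega>"
    unfolding AE_all_countable using AE_d_stable_hull[OF ys(2) X u] ..
  with d_concat_left[OF A ysS u] show ?thesis unfolding ys(1) by eventually_elim simp
qed

lemma stable_finite_enumeration:
  assumes "stable_finite M E S N"
  shows "\<exists>z m. range z \<subseteq> S \<and> m \<in> L0s_nat M \<and>
    (\<forall>w\<in>N. \<forall>u\<in>S. AE \<omega> in M. \<exists>i<m \<omega>. d (z i) u \<omega> = d w u \<omega>)"
proof -
  obtain A Xs where A: "is_partition M A"
    and Xs: "\<forall>k. finite (Xs k) \<and> Xs k \<noteq> {} \<and> Xs k \<subseteq> S"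
    and N: "N = concat_sets M E A (\<lambda>k. stable_hull M E (Xs k))"
    using assms unfolding stable_finite_def by (elim exE conjE)
  obtain n where n: "n \<in> L0s_nat M" "\<And>k \<omega>. \<omega> \<in> A k \<Longrightarrow> n \<omega> = k"
    using A by (rule is_partition_index) blast
  define p where "p i j = from_nat_into (Xs j) i" for i j
  have "p i j \<in> Xs j" for i j using Xs by (simp add: p_def from_nat_into)
  then have p: "range (p i) \<subseteq> S" for i using Xs by blast
  define z where "z i = concat M E A (p i)" for i
  have cover: "AE \<omega> in M. \<exists>i<card (Xs (n \<omega>)). d (z i) u \<omega> = d w u \<omega>"
    if w: "w \<in> N" and u: "u \<in> S" for w u
  proof -
    have "AE \<omega> in M. \<forall>i j. \<omega> \<in> A j \<longrightarrow> d (z i) u \<omega> = d (p i j) u \<omega>"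
      unfolding z_def AE_all_countable[where P = "\<lambda>i \<omega>. \<forall>j. Q i j \<omega>" for Q]
      using d_concat_left[OF A p u] ..
    moreover have "AE \<omega> in M. \<forall>j. \<omega> \<in> A j \<longrightarrow> (\<exists>x\<in>Xs j. d w u \<omega> = d x u \<omega>)"
      using Xs w u unfolding N by (intro AE_d_concat_sets_stable_hull[OF A]) auto
    ultimately show ?thesis using AE_space
    proof eventually_elim
      case (elim \<omega>)
      then obtain j x where j: "\<omega> \<in> A j" and x: "x \<in> Xs j" "d w u \<omega> = d x u \<omega>"
        using is_partition_cover[OF A] by blast
      obtain i where "i < card (Xs j)" "x = p i j"
        using ex_from_nat_into_less_card[OF _ x(1)] Xs unfolding p_def by blast
      with elim(1) j x(2) show ?case unfolding n(2)[OF j] by auto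
    qed
  qed
  have "range z \<subseteq> S" unfolding z_def using concat_in[OF A p] by blast
  moreover have "(\<lambda>\<omega>. card (Xs (n \<omega>))) \<in> L0s_nat M"
    by (rule L0s_nat_compose[OF L0s_nat_const n(1)])
  ultimately show ?thesis using cover by blast
qed

lemma random_net_if_stable_finite_cover:
  assumes N: "stable_finite M E S N" and cover: "S \<subseteq> (\<Union>x\<in>N. sball M S d x r)"
  shows "\<exists>z m. random_net r z m"
proof -
  obtain z m where z: "range z \<subseteq> S" "m \<in> L0s_nat M"
    and enum: "\<And>w u. w \<in> N \<Longrightarrow> u \<in> S \<Longrightarrow> AE \<omega> in M. \<exists>i<m \<omega>. d (z i) u \<omega> = d w u \<omega>"
    using stable_finite_enumeration[OF N] by blast
  have "AE \<omega> in M. \<exists>i<m \<omega>. d (z i) u \<omega> < r \<omega>" if u: "u \<in> S" for u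
  proof -
    obtain w where w: "w \<in> N" "AE \<omega> in M. d w u \<omega> < r \<omega>"
      using subsetD[OF cover u] by (auto simp: mem_sball_iff)
    from w(2) enum[OF w(1) u] show ?thesis by eventually_elim auto
  qed
  with z show ?thesis unfolding random_net_def by blast
qed

lemma stable_totally_bounded_iff:
  "stable_totally_bounded M E S d \<longleftrightarrow> (\<forall>r\<in>L0pp M. \<exists>z m. random_net r z m)"
  unfolding stable_totally_bounded_def
  using stable_finite_cover_if_random_net random_net_if_stable_finite_cover measurable_L0pp
  by (metis order_refl)

lemma ex_farthest:
  assumes F: "finite F" "F \<subseteq> S" and r: "r \<in> borel_measurable M"
  shows "\<exists>y\<in>S. \<forall>v\<in>S. AE \<omega> in M. (\<forall>f\<in>F. r \<omega> \<le> d f v \<omega>) \<longrightarrow> (\<forall>f\<in>F. r \<omega> \<le> d f y \<omega>)"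
proof (rule ex_essentially_largest_local[OF _ _ stable_set order_refl])
  show "is_local (\<lambda>y \<omega>. \<forall>f\<in>F. r \<omega> \<le> d f y \<omega>)"
    using F by (intro is_localI[of F] countable_finite) auto
  fix v assume "v \<in> S"
  then have "Measurable.pred M (\<lambda>\<omega>. d f v \<omega> < r \<omega>)" if "f \<in> F" for f
    using pred_d_less[OF _ _ r] F(2) that by blast
  then have "Measurable.pred M (\<lambda>\<omega>. r \<omega> \<le> d f v \<omega>)" if "f \<in> F" for f
    unfolding not_less[symmetric] using that by (intro pred_intros_logic)
  then show "Measurable.pred M (\<lambda>\<omega>. \<forall>f\<in>F. r \<omega> \<le> d f v \<omega>)" using F(1) by measurable
qed

lemma ex_greedy_seq:
  assumes r: "r \<in> borel_measurable M"
  shows "\<exists>x :: nat \<Rightarrow> 'a. range x \<subseteq> S \<and>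
    (\<forall>k. \<forall>v\<in>S. AE \<omega> in M. (\<forall>i<k. r \<omega> \<le> d (x i) v \<omega>) \<longrightarrow> (\<forall>i<k. r \<omega> \<le> d (x i) (x k) \<omega>))"
proof -
  have "\<exists>x :: nat \<Rightarrow> 'a. \<forall>k. x k \<in> S \<and>
      (\<forall>v\<in>S. AE \<omega> in M. (\<forall>i<k. r \<omega> \<le> d (x i) v \<omega>) \<longrightarrow> (\<forall>i<k. r \<omega> \<le> d (x i) (x k) \<omega>))"
  proof (rule dependent_wf_choice[OF wf_less_than, where P = "\<lambda>x k y. y \<in> S \<and>
      (\<forall>v\<in>S. AE \<omega> in M. (\<forall>i<k. r \<omega> \<le> d (x i) v \<omega>) \<longrightarrow> (\<forall>i<k. r \<omega> \<le> d (x i) y \<omega>))"])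
    fix x :: "nat \<Rightarrow> 'a" and k
    assume "\<And>i. (i, k) \<in> less_than \<Longrightarrow> x i \<in> S \<and>
      (\<forall>v\<in>S. AE \<omega> in M. (\<forall>l<i. r \<omega> \<le> d (x l) v \<omega>) \<longrightarrow> (\<forall>l<i. r \<omega> \<le> d (x l) (x i) \<omega>))"
    then have "x ` {..<k} \<subseteq> S" by auto
    from ex_farthest[OF _ this r] show "\<exists>y. y \<in> S \<and>
      (\<forall>v\<in>S. AE \<omega> in M. (\<forall>i<k. r \<omega> \<le> d (x i) v \<omega>) \<longrightarrow> (\<forall>i<k. r \<omega> \<le> d (x i) y \<omega>))"
      by (simp add: Bex_def Ball_image_comp lessThan_def)
  qed (simp cong: conj_cong)
  then show ?thesis by blast
qed

lemma AE_close_pair_if_AE_clusters: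
  assumes x: "range x \<subseteq> S" and y: "y \<in> S" and cluster: "AE_clusters x y" and r: "r \<in> L0pp M"
  shows "AE \<omega> in M. \<exists>k. \<exists>i<k. d (x i) (x k) \<omega> < r \<omega>"
proof -
  have "AE \<omega> in M. \<forall>i j. d (x i) (x j) \<omega> \<le> d (x i) y \<omega> + d (x j) y \<omega>"
    unfolding AE_all_countable using d_triangle2 x y by blast
  moreover have "AE \<omega> in M. 0 < r \<omega>" by (rule L0pp_pos[OF r])
  ultimately show ?thesis
    using cluster unfolding AE_clusters_def frequently_sequentially
  proof eventually_elim
    case (elim \<omega>)
    then obtain i where i: "d (x i) y \<omega> < r \<omega> / 2" by (meson half_gt_zero)
    obtain k where "k \<ge> Suc i" "d (x k) y \<omega> < r \<omega> / 2" using elim by (meson half_gt_zero)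
    with i elim(1) show ?case by (smt (verit) Suc_le_eq field_sum_of_halves)
  qed
qed

lemma stable_totally_bounded_if_stable_seq_compact:
  assumes "stable_seq_compact M E S d"
  shows "stable_totally_bounded M E S d"
  unfolding stable_totally_bounded_iff
proof
  fix r assume r [measurable]: "r \<in> L0pp M"
  obtain x :: "nat \<Rightarrow> 'a" where x: "range x \<subseteq> S" and greedy: "\<And>k v. v \<in> S \<Longrightarrow>
      AE \<omega> in M. (\<forall>i<k. r \<omega> \<le> d (x i) v \<omega>) \<longrightarrow> (\<forall>i<k. r \<omega> \<le> d (x i) (x k) \<omega>)"
    using ex_greedy_seq[OF measurable_L0pp[OF r]] by blast
  obtain y where y: "y \<in> S" and cluster: "AE_clusters x y"
    using assms x unfolding stable_seq_compact_iff by blast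
  have close_pair: "AE \<omega> in M. \<exists>k. \<exists>i<k. d (x i) (x k) \<omega> < r \<omega>"
    by (rule AE_close_pair_if_AE_clusters[OF x y cluster r])
  have [measurable]: "d (x i) (x j) \<in> borel_measurable M" for i j using d_measurable x by blast
  define m where "m \<omega> = (LEAST k. \<exists>i<k. d (x i) (x k) \<omega> < r \<omega>)" for \<omega>
  have "random_net r x m"
    unfolding random_net_def
  proof (intro conjI ballI x)
    show "m \<in> L0s_nat M" unfolding m_def by (rule L0s_nat_Least) measurable
    fix u assume "u \<in> S"
    then have "AE \<omega> in M. \<forall>k. (\<forall>i<k. r \<omega> \<le> d (x i) u \<omega>) \<longrightarrow> (\<forall>i<k. r \<omega> \<le> d (x i) (x k) \<omega>)"
      unfolding AE_all_countable using greedy by blast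
    with close_pair show "AE \<omega> in M. \<exists>i<m \<omega>. d (x i) u \<omega> < r \<omega>"
    proof eventually_elim
      case (elim \<omega>)
      from elim(1) have "\<exists>i<m \<omega>. d (x i) (x (m \<omega>)) \<omega> < r \<omega>" unfolding m_def by (rule LeastI_ex)
      with elim(2) show ?case by (meson not_le)
    qed
  qed
  then show "\<exists>z m. random_net r z m" by blast
qed

section \<open>Stable filter bases\<close>

definition stable_filter_base :: "'a set set \<Rightarrow> bool"
  where "stable_filter_base B \<longleftrightarrow> stable_collection M E B \<and> (\<forall>U\<in>B. U \<subseteq> S) \<and>
    (\<forall>U\<in>B. \<forall>U'\<in>B. \<exists>W\<in>B. W \<subseteq> U \<inter> U')"

lemma stable_filter_baseD:
  assumes "stable_filter_base B"
  shows "B \<noteq> {}" "U \<in> B \<Longrightarrow> stable_set M E U" "U \<in> B \<Longrightarrow> U \<subseteq> S" "U \<in> B \<Longrightarrow> U \<noteq> {}"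
    and "is_partition M A \<Longrightarrow> range Us \<subseteq> B \<Longrightarrow> concat_sets M E A Us \<in> B"
  using assms by (auto simp: stable_filter_base_def stable_collection_def stable_set_def)

lemma stable_filter_base_finite_Int:
  assumes B: "stable_filter_base B" and G: "\<And>i. G i \<in> B"
  shows "\<exists>W\<in>B. \<forall>i<(k::nat). W \<subseteq> G i"
proof (induction k)
  case 0
  show ?case using stable_filter_baseD(1)[OF B] by blast
next
  case (Suc k)
  then obtain W where W: "W \<in> B" "\<forall>i<k. W \<subseteq> G i" by blast
  then obtain W' where "W' \<in> B" "W' \<subseteq> W \<inter> G k"
    using B G unfolding stable_filter_base_def by meson
  with W(2) show ?case by (intro bexI[of _ W']) (auto simp: less_Suc_eq)
qed

lemma stable_filter_base_if_is_filter_base: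
  assumes F: "is_filter_on S F" and base: "is_filter_base F B" and B: "stable_collection M E B"
  shows "stable_filter_base B"
  unfolding stable_filter_base_def
proof (intro conjI ballI B)
  have BF: "B \<subseteq> F" using base by (simp add: is_filter_base_def)
  with F show "U \<subseteq> S" if "U \<in> B" for U using that unfolding is_filter_on_def by blast
  fix U U' assume "U \<in> B" "U' \<in> B"
  with BF F have "U \<inter> U' \<in> F" by (simp add: is_filter_on_def subset_iff)
  with base show "\<exists>W\<in>B. W \<subseteq> U \<inter> U'" unfolding is_filter_base_def by blast
qed

lemma stable_filter_if_stable_filter_base:
  assumes B: "stable_filter_base B"
  shows "stable_filter M E S {U. U \<subseteq> S \<and> (\<exists>V\<in>B. V \<subseteq> U)}" (is "stable_filter M E S ?F")
  unfolding stable_filter_def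
proof (intro conjI exI)
  show "is_filter_on S ?F"
    unfolding is_filter_on_def
  proof (intro conjI ballI allI impI)
    show "S \<in> ?F" using stable_filter_baseD(1,3)[OF B] by blast
    show "{} \<notin> ?F" using stable_filter_baseD(4)[OF B] by blast
    fix U U' assume U: "U \<in> ?F" "U' \<in> ?F"
    then obtain V V' where V: "V \<in> B" "V \<subseteq> U" "V' \<in> B" "V' \<subseteq> U'" by blast
    then obtain W where "W \<in> B" "W \<subseteq> V \<inter> V'" using B unfolding stable_filter_base_def by meson
    with V U show "U \<inter> U' \<in> ?F" by blast
  qed auto
  show "is_filter_base ?F B"
    using stable_filter_baseD(3)[OF B] by (auto simp: is_filter_base_def)
  show "stable_collection M E B" using B by (simp add: stable_filter_base_def)
qed

lemma cluster_point_iff: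
  assumes base: "is_filter_base F B" and x: "x \<in> S"
  shows "cluster_point M S d F x \<longleftrightarrow> (\<forall>U\<in>B. \<forall>r\<in>L0pp M. U \<inter> sball M S d x r \<noteq> {})"
proof
  assume cluster: "cluster_point M S d F x"
  show "\<forall>U\<in>B. \<forall>r\<in>L0pp M. U \<inter> sball M S d x r \<noteq> {}"
  proof (intro ballI)
    fix U r assume "U \<in> B" and r: "r \<in> L0pp M"
    then have "U \<in> F" using base by (auto simp: is_filter_base_def)
    then show "U \<inter> sball M S d x r \<noteq> {}"
      using cluster sopen_sball[OF x r] centre_in_sball[OF x r]
      unfolding cluster_point_def by blast
  qed
next
  assume meets: "\<forall>U\<in>B. \<forall>r\<in>L0pp M. U \<inter> sball M S d x r \<noteq> {}"
  have "V \<inter> U \<noteq> {}" if "U \<in> F" "sopen M S d V" "x \<in> V" for U V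
  proof -
    obtain U' where "U' \<in> B" "U' \<subseteq> U"
      using base \<open>U \<in> F\<close> unfolding is_filter_base_def by blast
    moreover obtain r where "r \<in> L0pp M" "sball M S d x r \<subseteq> V"
      using sopen_contains_sball[OF \<open>sopen M S d V\<close> \<open>x \<in> V\<close>] .
    ultimately show ?thesis using meets by blast
  qed
  with x show "cluster_point M S d F x" by (auto simp: cluster_point_def)
qed

lemma stable_compact_iff:
  "stable_compact M E S d \<longleftrightarrow>
    (\<forall>B. stable_filter_base B \<longrightarrow> (\<exists>x\<in>S. \<forall>U\<in>B. \<forall>r\<in>L0pp M. U \<inter> sball M S d x r \<noteq> {}))"
proof
  assume compact: "stable_compact M E S d"
  show "\<forall>B. stable_filter_base B \<longrightarrow> (\<exists>x\<in>S. \<forall>U\<in>B. \<forall>r\<in>L0pp M. U \<inter> sball M S d x r \<noteq> {})"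
  proof (intro allI impI)
    fix B assume B: "stable_filter_base B"
    define F where "F = {U. U \<subseteq> S \<and> (\<exists>V\<in>B. V \<subseteq> U)}"
    have "stable_filter M E S F"
      unfolding F_def by (rule stable_filter_if_stable_filter_base[OF B])
    then obtain x where "x \<in> S" "cluster_point M S d F x"
      using compact unfolding stable_compact_def by blast
    moreover have "is_filter_base F B"
      using stable_filter_baseD(3)[OF B] by (auto simp: F_def is_filter_base_def)
    ultimately show "\<exists>x\<in>S. \<forall>U\<in>B. \<forall>r\<in>L0pp M. U \<inter> sball M S d x r \<noteq> {}"
      using cluster_point_iff by blast
  qed
next
  assume meets: "\<forall>B. stable_filter_base B \<longrightarrow> (\<exists>x\<in>S. \<forall>U\<in>B. \<forall>r\<in>L0pp M. U \<inter> sball M S d x r \<noteq> {})"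
  show "stable_compact M E S d"
    unfolding stable_compact_def
  proof (intro allI impI)
    fix F assume "stable_filter M E S F"
    then obtain B where base: "is_filter_base F B" and "stable_filter_base B"
      using stable_filter_base_if_is_filter_base unfolding stable_filter_def by blast
    then obtain x where "x \<in> S" "\<forall>U\<in>B. \<forall>r\<in>L0pp M. U \<inter> sball M S d x r \<noteq> {}"
      using meets by blast
    then show "\<exists>x\<in>S. cluster_point M S d F x" using cluster_point_iff[OF base] by blast
  qed
qed

lemma stable_collection_range:
  assumes R: "stable_set_seq M E R" and stable: "\<And>n. n \<in> L0s_nat M \<Longrightarrow> stable_set M E (R n)"
  shows "stable_collection M E (R ` L0s_nat M)"
  unfolding stable_collection_def
proof (intro conjI allI impI; (elim conjE)?)
  fix A and Vs :: "nat \<Rightarrow> 'a set"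
  assume A: "is_partition M A" and "range Vs \<subseteq> R ` L0s_nat M"
  then have "\<forall>k. \<exists>n. n \<in> L0s_nat M \<and> Vs k = R n" by blast
  then obtain ns where ns: "\<And>k. ns k \<in> L0s_nat M" and "\<And>k. Vs k = R (ns k)" by metis
  then have Vs: "Vs = (\<lambda>k. R (ns k))" by auto
  obtain i where i: "i \<in> L0s_nat M" "\<And>k \<omega>. \<omega> \<in> A k \<Longrightarrow> i \<omega> = k"
    using A by (rule is_partition_index) blast
  define m where "m \<omega> = ns (i \<omega>) \<omega>" for \<omega>
  have m: "m \<in> L0s_nat M" unfolding m_def by (rule L0s_nat_compose[OF ns i(1)])
  have "is_nat_concat M A ns m" using i(2) by (auto simp: is_nat_concat_def m_def)
  moreover have "range ns \<subseteq> L0s_nat M" using ns by blast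
  ultimately have "R m = concat_sets M E A Vs"
    using R A m unfolding stable_set_seq_def Vs by blast
  with m show "concat_sets M E A Vs \<in> R ` L0s_nat M" by blast
qed (use stable L0s_nat_const in auto)

lemma decreasing_closed_property_if_stable_compact:
  assumes "stable_compact M E S d"
  shows "decreasing_closed_property M E S d"
  unfolding decreasing_closed_property_def
proof (intro allI impI, elim conjE)
  fix R
  assume R: "stable_set_seq M E R"
    and stable_closed: "\<forall>n\<in>L0s_nat M. stable_set M E (R n) \<and> sclosed M S d (R n)"
    and decreasing: "\<forall>n\<in>L0s_nat M. \<forall>m\<in>L0s_nat M. nat_le M n m \<longrightarrow> R m \<subseteq> R n"
  have "stable_filter_base (R ` L0s_nat M)"
    unfolding stable_filter_base_def
  proof (intro conjI ballI)
    show "stable_collection M E (R ` L0s_nat M)"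
      using stable_collection_range[OF R] stable_closed by blast
    show "U \<subseteq> S" if "U \<in> R ` L0s_nat M" for U using that stable_closed by (auto simp: sclosed_def)
    fix U U' assume "U \<in> R ` L0s_nat M" "U' \<in> R ` L0s_nat M"
    then obtain n m where n: "n \<in> L0s_nat M" "U = R n" and m: "m \<in> L0s_nat M" "U' = R m" by blast
    have "R (\<lambda>\<omega>. max (n \<omega>) (m \<omega>)) \<subseteq> U \<inter> U'"
      using decreasing n m L0s_nat_max[OF n(1) m(1)] by (simp add: nat_le_def)
    then show "\<exists>W\<in>R ` L0s_nat M. W \<subseteq> U \<inter> U'" using L0s_nat_max[OF n(1) m(1)] by blast
  qed
  then obtain x where x: "x \<in> S"
    and meets: "\<forall>U\<in>R ` L0s_nat M. \<forall>r\<in>L0pp M. U \<inter> sball M S d x r \<noteq> {}"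
    using assms stable_compact_iff by meson
  have "x \<in> R n" if n: "n \<in> L0s_nat M" for n
  proof (rule ccontr)
    assume "x \<notin> R n"
    then have "sopen M S d (S - R n)" "x \<in> S - R n"
      using stable_closed n x by (auto simp: sclosed_def)
    then obtain r where "r \<in> L0pp M" "sball M S d x r \<subseteq> S - R n" by (rule sopen_contains_sball)
    with meets n show False by blast
  qed
  then show "(\<Inter>n\<in>L0s_nat M. R n) \<noteq> {}" by blast
qed

section \<open>Total boundedness and completeness imply compactness\<close>

lemma concat_sets_Int:
  assumes A: "is_partition M A" and U: "\<And>k. stable_set M E (U k)" "\<And>k. U k \<subseteq> S"
    and V: "stable_set M E V" "V \<subseteq> S" and meets: "\<And>k. U k \<inter> V \<noteq> {}"
  shows "concat_sets M E A (\<lambda>k. U k \<inter> V) = concat_sets M E A U \<inter> V"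
proof (intro equalityI subsetI)
  fix x assume "x \<in> concat_sets M E A (\<lambda>k. U k \<inter> V)"
  then obtain xs where xs: "\<forall>k. xs k \<in> U k \<inter> V" "x = concat M E A xs"
    by (auto simp: concat_sets_def)
  then have "range xs \<subseteq> V" by blast
  then have "x \<in> V" using A V(1) xs(2) by (simp add: stable_set_def)
  with xs show "x \<in> concat_sets M E A U \<inter> V" by (auto simp: concat_sets_def)
next
  fix x assume x: "x \<in> concat_sets M E A U \<inter> V"
  then have xS: "x \<in> S" using V(2) by blast
  have in_S: "U k \<inter> V \<subseteq> S" for k using V(2) by blast
  show "x \<in> concat_sets M E A (\<lambda>k. U k \<inter> V)"
    unfolding mem_concat_sets_iff[OF A in_S]
  proof (intro conjI allI xS)
    fix k
    have Ak: "A k \<in> sets M" using A by (simp add: is_partition_def)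
    from x have "x \<in> concat_sets M E A U" by blast
    then obtain u where u: "u \<in> U k" "AE \<omega>\<in>A k in M. d x u \<omega> = 0"
      unfolding mem_concat_sets_iff[OF A U(2)] by blast
    obtain w where w: "w \<in> U k" "w \<in> V" using meets by blast
    have S: "u \<in> S" "w \<in> S" using u w U(2) by blast+
    have "paste (A k) x w = paste (A k) u w"
      by (rule paste_cong[OF Ak xS S u(2)])
    then have "paste (A k) x w \<in> U k \<inter> V"
      using paste_in_stable_set[OF U(1) Ak u(1) w(1)]
        paste_in_stable_set[OF V(1) Ak _ w(2), of x] x by simp
    moreover have "AE \<omega>\<in>A k in M. d x (paste (A k) x w) \<omega> = 0"
      using AE_d_paste_eq_0[OF Ak xS S(2)] by eventually_elim blast
    ultimately show "\<exists>y\<in>U k \<inter> V. AE \<omega>\<in>A k in M. d x y \<omega> = 0" by blast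
  qed
qed

lemma stable_set_Int:
  "stable_set M E U \<Longrightarrow> stable_set M E V \<Longrightarrow> U \<inter> V \<noteq> {} \<Longrightarrow> stable_set M E (U \<inter> V)"
  by (auto simp: stable_set_def)

lemma stable_filter_base_Int:
  assumes B: "stable_filter_base B" and V: "stable_set M E V" "V \<subseteq> S"
    and meets: "\<And>U. U \<in> B \<Longrightarrow> U \<inter> V \<noteq> {}"
  shows "stable_filter_base ((\<lambda>U. U \<inter> V) ` B)"
  unfolding stable_filter_base_def stable_collection_def
proof (intro conjI ballI allI impI; (elim conjE)?)
  show "(\<lambda>U. U \<inter> V) ` B \<noteq> {}" using stable_filter_baseD(1)[OF B] by blast
  show "stable_set M E W" if W: "W \<in> (\<lambda>U. U \<inter> V) ` B" for W
    using W stable_filter_baseD(2)[OF B] V(1) meets by (auto intro: stable_set_Int)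
  show "W \<subseteq> S" if "W \<in> (\<lambda>U. U \<inter> V) ` B" for W using that V(2) by blast
next
  fix U U' assume "U \<in> (\<lambda>U. U \<inter> V) ` B" "U' \<in> (\<lambda>U. U \<inter> V) ` B"
  then obtain U\<^sub>0 U\<^sub>1 where U: "U\<^sub>0 \<in> B" "U = U\<^sub>0 \<inter> V" "U\<^sub>1 \<in> B" "U' = U\<^sub>1 \<inter> V" by blast
  then obtain W where W: "W \<in> B" "W \<subseteq> U\<^sub>0 \<inter> U\<^sub>1" using B unfolding stable_filter_base_def by meson
  then have "W \<inter> V \<subseteq> U \<inter> U'" unfolding U(2,4) by blast
  then show "\<exists>W\<in>(\<lambda>U. U \<inter> V) ` B. W \<subseteq> U \<inter> U'" by (rule bexI[OF _ imageI[OF W(1)]])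
next
  fix A and Ws :: "nat \<Rightarrow> 'a set"
  assume A: "is_partition M A" and Ws: "range Ws \<subseteq> (\<lambda>U. U \<inter> V) ` B"
  have "Ws k \<in> (\<lambda>U. U \<inter> V) ` B" for k using Ws by blast
  then have "\<exists>U\<in>B. Ws k = U \<inter> V" for k by (simp add: image_iff)
  then obtain Us where Us: "\<And>k. Us k \<in> B" and "\<And>k. Ws k = Us k \<inter> V" by metis
  then have "Ws = (\<lambda>k. Us k \<inter> V)" by (intro ext)
  then have "concat_sets M E A Ws = concat_sets M E A (\<lambda>k. Us k \<inter> V)" by simp
  also have "\<dots> = concat_sets M E A Us \<inter> V"
    by (rule concat_sets_Int[OF A]) (use stable_filter_baseD(2,3)[OF B] Us V meets in auto)
  finally show "concat_sets M E A Ws \<in> (\<lambda>U. U \<inter> V) ` B"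
    using stable_filter_baseD(5)[OF B A, of Us] Us by blast
qed

definition nearest :: "('w \<Rightarrow> real) \<Rightarrow> 'a \<Rightarrow> 'a set \<Rightarrow> 'a \<Rightarrow> bool"
  where "nearest r z U u \<longleftrightarrow> u \<in> U \<and> (\<forall>v\<in>U. AE \<omega> in M. d z v \<omega> < r \<omega> \<longrightarrow> d z u \<omega> < r \<omega>)"

lemma ex_nearest:
  assumes U: "stable_set M E U" "U \<subseteq> S" and z: "z \<in> S" and r: "r \<in> borel_measurable M"
  shows "\<exists>u. nearest r z U u"
proof -
  have "Measurable.pred M (\<lambda>\<omega>. d z v \<omega> < r \<omega>)" if "v \<in> U" for v
    using pred_d_less[OF z _ r] U(2) that by blast
  then show ?thesis
    unfolding nearest_def using ex_essentially_largest_local[OF is_local_d_less[OF z] _ U] by blast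
qed

lemma AE_near_nearest_if_near_concat_sets:
  assumes A: "is_partition M A" and U: "\<And>k. U k \<subseteq> S" and z: "z \<in> S"
    and g: "\<And>k. nearest r z (U k) (g k)" and u: "u \<in> concat_sets M E A U"
  shows "AE \<omega> in M. \<forall>k. \<omega> \<in> A k \<longrightarrow> d z u \<omega> < r \<omega> \<longrightarrow> d z (g k) \<omega> < r \<omega>"
proof -
  obtain us where us: "u = concat M E A us" "\<And>k. us k \<in> U k"
    using u by (auto simp: concat_sets_def)
  then have "range us \<subseteq> S" using U by blast
  moreover have "AE \<omega> in M. \<forall>k. d z (us k) \<omega> < r \<omega> \<longrightarrow> d z (g k) \<omega> < r \<omega>"
    unfolding AE_all_countable using g us(2) by (simp add: nearest_def)
  ultimately show ?thesis
    using d_concat_right[OF A _ z, of us] unfolding us(1) by (auto elim: eventually_elim2)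
qed

lemma ex_essentially_farthest_member:
  assumes B: "stable_filter_base B" and z: "z \<in> S" and r: "r \<in> borel_measurable M"
    and h: "\<And>U. U \<in> B \<Longrightarrow> nearest r z U (h U)"
  shows "\<exists>G\<in>B. \<forall>U\<in>B. AE \<omega> in M. d z (h G) \<omega> < r \<omega> \<longrightarrow> d z (h U) \<omega> < r \<omega>"
proof -
  have "h U \<in> S" if "U \<in> B" for U
    using h[OF that] stable_filter_baseD(3)[OF B that] by (auto simp: nearest_def)
  then have pred: "Measurable.pred M (\<lambda>\<omega>. \<not> d z (h U) \<omega> < r \<omega>)" if "U \<in> B" for U
    using pred_d_less[OF z _ r] that by (simp add: pred_intros_logic)
  have "\<exists>G\<in>B. \<forall>U\<in>B. AE \<omega> in M. \<not> d z (h U) \<omega> < r \<omega> \<longrightarrow> \<not> d z (h G) \<omega> < r \<omega>"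
  proof (rule ex_essentially_largest[OF stable_filter_baseD(1)[OF B] pred])
    fix Us :: "nat \<Rightarrow> 'a set" assume "range Us \<subseteq> B"
    then have Us: "Us k \<in> B" for k by blast
    note [measurable] = pred[OF Us]
    define n where "n \<omega> = (LEAST k. \<not> d z (h (Us k)) \<omega> < r \<omega>)" for \<omega>
    have "n \<in> L0s_nat M" unfolding n_def by (rule L0s_nat_Least) measurable
    then have A: "is_partition M (\<lambda>j. {\<omega>\<in>space M. n \<omega> = j})" by (rule is_partition_level_sets)
    define U where "U = concat_sets M E (\<lambda>j. {\<omega>\<in>space M. n \<omega> = j}) Us"
    have U: "U \<in> B" unfolding U_def by (rule stable_filter_baseD(5)[OF B A]) (use Us in blast)
    then have "h U \<in> U" using h by (simp add: nearest_def)
    then have "AE \<omega> in M. \<forall>k. \<omega> \<in> {\<omega>\<in>space M. n \<omega> = k} \<longrightarrow>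
        d z (h U) \<omega> < r \<omega> \<longrightarrow> d z (h (Us k)) \<omega> < r \<omega>"
      unfolding U_def using stable_filter_baseD(3)[OF B Us] h[OF Us]
      by (intro AE_near_nearest_if_near_concat_sets[OF A _ z])
    with AE_space have "AE \<omega> in M. (\<exists>k. \<not> d z (h (Us k)) \<omega> < r \<omega>) \<longrightarrow> \<not> d z (h U) \<omega> < r \<omega>"
      by eventually_elim (auto simp: n_def dest: LeastI)
    with U show "\<exists>U\<in>B. AE \<omega> in M. (\<exists>k. \<not> d z (h (Us k)) \<omega> < r \<omega>) \<longrightarrow> \<not> d z (h U) \<omega> < r \<omega>" by blast
  qed
  then obtain G where "G \<in> B" and G: "\<And>U. U \<in> B \<Longrightarrow>
      AE \<omega> in M. \<not> d z (h U) \<omega> < r \<omega> \<longrightarrow> \<not> d z (h G) \<omega> < r \<omega>" by blast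
  have "AE \<omega> in M. d z (h G) \<omega> < r \<omega> \<longrightarrow> d z (h U) \<omega> < r \<omega>" if "U \<in> B" for U
    using G[OF that] by eventually_elim blast
  with \<open>G \<in> B\<close> show ?thesis by blast
qed

text \<open>Pigeonhole: at almost every \<open>\<omega>\<close> one of the finitely many centres stays within \<open>r \<omega>\<close> of every
  member of the base, for otherwise finitely many members would intersect in a set that the net
  misses.\<close>

lemma AE_ex_centre_near_base:
  assumes net: "random_net r z m" and B: "stable_filter_base B"
    and h: "\<And>i U. U \<in> B \<Longrightarrow> nearest r (z i) U (h i U)"
    and G: "\<And>i. G i \<in> B"
  shows "AE \<omega> in M. \<exists>i. d (z i) (h i (G i)) \<omega> < r \<omega>"
proof -
  have "\<exists>w W. W \<in> B \<and> w \<in> W \<and> (\<forall>i<k. W \<subseteq> G i)" for k :: nat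
  proof -
    obtain W where "W \<in> B" "\<forall>i<k. W \<subseteq> G i"
      using stable_filter_base_finite_Int[where G = G, OF B G] by blast
    with stable_filter_baseD(4)[OF B] show ?thesis by blast
  qed
  then obtain w W where W: "\<And>k. W k \<in> B" "\<And>k. w k \<in> W k" "\<And>k i. i < k \<Longrightarrow> W k \<subseteq> G i" by metis
  have "w k \<in> S" for k using W(1,2) stable_filter_baseD(3)[OF B] by blast
  then have "AE \<omega> in M. \<forall>k. \<exists>i<m \<omega>. d (z i) (w k) \<omega> < r \<omega>"
    using net unfolding AE_all_countable random_net_def by blast
  moreover have "AE \<omega> in M. i < k \<longrightarrow> d (z i) (w k) \<omega> < r \<omega> \<longrightarrow> d (z i) (h i (G i)) \<omega> < r \<omega>" for i k
  proof (cases "i < k")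
    case True
    then have "w k \<in> G i" using W(2,3) by blast
    with h[OF G, of i i] show ?thesis by (simp add: nearest_def)
  qed simp
  then have "AE \<omega> in M. \<forall>i k. i < k \<longrightarrow> d (z i) (w k) \<omega> < r \<omega> \<longrightarrow> d (z i) (h i (G i)) \<omega> < r \<omega>"
    by (simp add: AE_all_countable)
  ultimately show ?thesis by eventually_elim blast
qed

lemma ex_ball_meeting_base:
  assumes net: "random_net r z m" and r [measurable]: "r \<in> borel_measurable M"
    and B: "stable_filter_base B"
  shows "\<exists>y\<in>S. \<forall>U\<in>B. U \<inter> sball M S d y r \<noteq> {}"
proof -
  have z: "range z \<subseteq> S" using net by (simp add: random_net_def)
  then have zS: "z i \<in> S" for i by blast
  have "\<exists>h. \<forall>U\<in>B. nearest r (z i) U (h U)" for i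
    using ex_nearest[OF _ _ zS r] stable_filter_baseD(2,3)[OF B] by (intro bchoice ballI) blast
  then obtain h where h: "\<And>i U. U \<in> B \<Longrightarrow> nearest r (z i) U (h i U)" by metis
  then have h_in: "h i U \<in> U" "h i U \<in> S" if "U \<in> B" for i U
    using h[OF that, of i] stable_filter_baseD(3)[OF B that] by (auto simp: nearest_def)
  obtain G where G: "\<And>i. G i \<in> B"
    "\<And>i U. U \<in> B \<Longrightarrow> AE \<omega> in M. d (z i) (h i (G i)) \<omega> < r \<omega> \<longrightarrow> d (z i) (h i U) \<omega> < r \<omega>"
    using ex_essentially_farthest_member[OF B zS r h] by metis
  note [measurable] = d_measurable[OF zS h_in(2)[OF G(1)]]
  define i where "i \<omega> = (LEAST i. d (z i) (h i (G i)) \<omega> < r \<omega>)" for \<omega>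
  have i: "i \<in> L0s_nat M" unfolding i_def by (rule L0s_nat_Least) measurable
  have "AE \<omega> in M. \<exists>i. d (z i) (h i (G i)) \<omega> < r \<omega>"
    by (rule AE_ex_centre_near_base[OF net B]) (simp_all add: h G(1))
  then have i_near: "AE \<omega> in M. d (z (i \<omega>)) (h (i \<omega>) (G (i \<omega>))) \<omega> < r \<omega>"
    unfolding i_def by eventually_elim (rule LeastI_ex)
  have "U \<inter> sball M S d (select z i) r \<noteq> {}" if U: "U \<in> B" for U
  proof (rule stable_set_meets_sball[of U "\<lambda>k. h k U"])
    have "AE \<omega> in M. \<forall>k. d (select z i) (h k U) \<omega> = d (z (i \<omega>)) (h k U) \<omega>"
      unfolding AE_all_countable using d_select_left[OF i z h_in(2)[OF U]] ..
    moreover have "AE \<omega> in M. \<forall>k. d (z k) (h k (G k)) \<omega> < r \<omega> \<longrightarrow> d (z k) (h k U) \<omega> < r \<omega>"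
      unfolding AE_all_countable using G(2)[OF U] ..
    ultimately show "AE \<omega> in M. \<exists>k. d (select z i) (h k U) \<omega> < r \<omega>"
      using i_near by eventually_elim metis
  qed (use stable_filter_baseD(2,3)[OF B U] h_in(1)[OF U] select_in[OF i z] in auto)
  with select_in[OF i z] show ?thesis by blast
qed

lemma ex_ball_meeting_base_in:
  assumes bounded: "stable_totally_bounded M E S d" and B: "stable_filter_base B"
    and V: "stable_set M E V" "V \<subseteq> S" and meets: "\<And>U. U \<in> B \<Longrightarrow> U \<inter> V \<noteq> {}" and "e > 0"
  shows "\<exists>y\<in>S. \<forall>U\<in>B. \<exists>u\<in>U \<inter> V. AE \<omega> in M. d y u \<omega> < e"
proof -
  obtain z m where "random_net (\<lambda>_. e) z m"
    using bounded L0pp_const[OF \<open>e > 0\<close>] unfolding stable_totally_bounded_iff by blast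
  then have "\<exists>y\<in>S. \<forall>U\<in>(\<lambda>U. U \<inter> V) ` B. U \<inter> sball M S d y (\<lambda>_. e) \<noteq> {}"
    by (rule ex_ball_meeting_base) (simp_all add: stable_filter_base_Int[OF B V meets])
  then show ?thesis by (fastforce simp: mem_sball_iff)
qed

lemma ex_balls_meeting_base:
  assumes bounded: "stable_totally_bounded M E S d" and B: "stable_filter_base B"
  shows "\<exists>y. range y \<subseteq> S \<and>
    (\<forall>k. \<forall>U\<in>B. \<exists>u\<in>U. AE \<omega> in M. \<forall>i<k. d (y i) u \<omega> < inverse (real (Suc i)))"
proof -
  define close where "close k c u \<longleftrightarrow> (AE \<omega> in M. d c u \<omega> < inverse (real (Suc k)))" for k c u
  define near where "near y k u \<longleftrightarrow> (AE \<omega> in M. \<forall>i<k. d (y i) u \<omega> < inverse (real (Suc i)))"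
    for y and k :: nat and u
  have near_Suc: "near y (Suc k) u \<longleftrightarrow> near y k u \<and> close k (y k) u" for y k u
    by (auto simp: near_def close_def less_Suc_eq all_conj_distrib)
  have near_0: "\<forall>U\<in>B. \<exists>u\<in>U. near y 0 u" for y
    using stable_filter_baseD(4)[OF B] by (auto simp: near_def ex_in_conv)
  have "\<exists>y. \<forall>k. y k \<in> S \<and> (\<forall>U\<in>B. \<exists>u\<in>U. near y k u \<and> close k (y k) u)"
  proof (rule dependent_wf_choice[OF wf_less_than, where P = "\<lambda>y k c. c \<in> S \<and>
      (\<forall>U\<in>B. \<exists>u\<in>U. near y k u \<and> close k c u)"])
    fix y :: "nat \<Rightarrow> 'a" and k
    assume IH: "\<And>l. (l, k) \<in> less_than \<Longrightarrow> y l \<in> S \<and>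
      (\<forall>U\<in>B. \<exists>u\<in>U. near y l u \<and> close l (y l) u)"
    have meets: "\<forall>U\<in>B. \<exists>u\<in>U. near y k u"
      using near_0 IH[of "k - 1"] near_Suc[of y "k - 1"] by (cases k) auto
    define V where "V = {v\<in>S. near y k v}"
    have meets_V: "U \<inter> V \<noteq> {}" if "U \<in> B" for U
      using meets that stable_filter_baseD(3)[OF B that] unfolding V_def by blast
    have "is_local (\<lambda>v \<omega>. \<forall>i<k. d (y i) v \<omega> < inverse (real (Suc i)))"
      using IH by (intro is_localI[of "y ` {..<k}"]) auto
    then have "stable_set M E V"
      unfolding V_def near_def using meets_V stable_filter_baseD(1)[OF B]
      by (intro stable_set_AE_local) (auto simp: V_def near_def)
    then obtain c where "c \<in> S" "\<forall>U\<in>B. \<exists>u\<in>U \<inter> V. close k c u"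
      using ex_ball_meeting_base_in[OF bounded B _ _ meets_V, of "inverse (real (Suc k))"]
      by (auto simp: V_def close_def)
    then show "\<exists>c. c \<in> S \<and> (\<forall>U\<in>B. \<exists>u\<in>U. near y k u \<and> close k c u)"
      unfolding V_def by blast
  qed (simp add: near_def)
  then obtain y where y: "\<And>k. y k \<in> S" "\<And>k. \<forall>U\<in>B. \<exists>u\<in>U. near y (Suc k) u"
    unfolding near_Suc by blast
  have "\<forall>U\<in>B. \<exists>u\<in>U. near y k u" for k using y(2) near_0 by (cases k) simp_all
  with y(1) show ?thesis unfolding near_def by blast
qed

lemma AE_Cauchy_if_near_common_points:
  assumes y: "range y \<subseteq> S"
    and near: "\<And>k. \<exists>u\<in>S. AE \<omega> in M. \<forall>i<k. d (y i) u \<omega> < inverse (real (Suc i))"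
  shows "AE_Cauchy y"
proof (rule AE_Cauchy_if_less_inverse_Suc)
  fix i j
  obtain u where u: "u \<in> S"
    "AE \<omega> in M. \<forall>l<Suc (max i j). d (y l) u \<omega> < inverse (real (Suc l))" using near by blast
  have "AE \<omega> in M. d (y i) (y j) \<omega> \<le> d (y i) u \<omega> + d (y j) u \<omega>"
    using d_triangle2 y u(1) by blast
  with u(2) show "AE \<omega> in M. d (y i) (y j) \<omega> < inverse (real (Suc i)) + inverse (real (Suc j))"
  proof eventually_elim
    case (elim \<omega>)
    have "d (y i) u \<omega> < inverse (real (Suc i))" "d (y j) u \<omega> < inverse (real (Suc j))"
      using elim(1) by (auto simp: less_Suc_eq_le)
    with elim(2) show ?case by simp
  qed
qed

lemma AE_ex_near_limit:
  assumes y: "range y \<subseteq> S" and x: "x \<in> S" and converges: "AE_converges y x"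
    and u: "range u \<subseteq> S" and near: "AE \<omega> in M. \<forall>k. d (y k) (u k) \<omega> < inverse (real (Suc k))"
    and r: "r \<in> L0pp M"
  shows "AE \<omega> in M. \<exists>k. d x (u k) \<omega> < r \<omega>"
proof -
  have "AE \<omega> in M. d x (u k) \<omega> \<le> d (y k) x \<omega> + d (y k) (u k) \<omega>" for k
  proof -
    have "y k \<in> S" "u k \<in> S" using y u by blast+
    from d_triangle[OF x this] d_commute[OF x this(1)] show ?thesis by eventually_elim simp
  qed
  then have "AE \<omega> in M. \<forall>k. d x (u k) \<omega> \<le> d (y k) x \<omega> + d (y k) (u k) \<omega>"
    by (simp add: AE_all_countable)
  moreover have "AE \<omega> in M. 0 < r \<omega>" by (rule L0pp_pos[OF r])
  ultimately show ?thesis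
    using converges near unfolding AE_converges_def
  proof eventually_elim
    case (elim \<omega>)
    have "\<forall>\<^sub>F k in sequentially. d (y k) x \<omega> < r \<omega> / 2" using elim(2,3) half_gt_zero by blast
    moreover have "\<forall>\<^sub>F k in sequentially. inverse (real (Suc k)) < r \<omega> / 2"
      using order_tendstoD(2)[OF LIMSEQ_inverse_real_of_nat] elim(2) half_gt_zero by blast
    ultimately have "\<forall>\<^sub>F k in sequentially. d x (u k) \<omega> < r \<omega>"
      by eventually_elim (use elim in \<open>smt (verit) field_sum_of_halves\<close>)
    then show ?case by (rule eventually_happens'[OF sequentially_bot])
  qed
qed

lemma stable_compact_if_stable_totally_bounded_stable_complete:
  assumes bounded: "stable_totally_bounded M E S d" and complete: "stable_complete M E S d"
  shows "stable_compact M E S d"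
  unfolding stable_compact_iff
proof (intro allI impI)
  fix B assume B: "stable_filter_base B"
  obtain y where y: "range y \<subseteq> S"
    and near: "\<And>k U. U \<in> B \<Longrightarrow> \<exists>u\<in>U. AE \<omega> in M. \<forall>i<k. d (y i) u \<omega> < inverse (real (Suc i))"
    using ex_balls_meeting_base[OF bounded B] by blast
  have "AE_Cauchy y"
    using near stable_filter_baseD(1,3)[OF B]
    by (intro AE_Cauchy_if_near_common_points[OF y]) blast
  then obtain x where x: "x \<in> S" "AE_converges y x"
    using complete y unfolding stable_complete_iff by blast
  have "U \<inter> sball M S d x r \<noteq> {}" if U: "U \<in> B" and r: "r \<in> L0pp M" for U r
  proof -
    have "\<forall>k. \<exists>u\<in>U. AE \<omega> in M. d (y k) u \<omega> < inverse (real (Suc k))"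
      using near[OF U, of "Suc _"] by (fastforce elim: eventually_mono)
    then obtain u where u: "\<And>k. u k \<in> U" "\<And>k. AE \<omega> in M. d (y k) (u k) \<omega> < inverse (real (Suc k))"
      by metis
    then have "AE \<omega> in M. \<forall>k. d (y k) (u k) \<omega> < inverse (real (Suc k))"
      by (simp add: AE_all_countable)
    then have "AE \<omega> in M. \<exists>k. d x (u k) \<omega> < r \<omega>"
      using u(1) stable_filter_baseD(3)[OF B U] by (intro AE_ex_near_limit[OF y x _ _ r]) blast
    with u(1) stable_filter_baseD(2,3)[OF B U] x(1) measurable_L0pp[OF r] show ?thesis
      by (intro stable_set_meets_sball) auto
  qed
  with x(1) show "\<exists>x\<in>S. \<forall>U\<in>B. \<forall>r\<in>L0pp M. U \<inter> sball M S d x r \<noteq> {}" by blast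
qed

end

theorem theorem5:
  fixes M :: "'w measure" and E :: "('w, 'a) L0_module"
    and S :: "'a set" and d :: "'a \<Rightarrow> 'a \<Rightarrow> 'w \<Rightarrow> real"
  assumes "prob_space M"
    and "stable_module M E"
    and "stable_set M E S"
    and "stable_metric M E S d"
  shows "(stable_compact M E S d \<longleftrightarrow> decreasing_closed_property M E S d)
       \<and> (decreasing_closed_property M E S d \<longleftrightarrow> stable_seq_compact M E S d)
       \<and> (stable_seq_compact M E S d \<longleftrightarrow>
            stable_totally_bounded M E S d \<and> stable_complete M E S d)"
proof -
  interpret stable_metric_space M E S d
    using assms prob_space.finite_measure[OF assms(1)]
    by (intro stable_metric_space.intro stable_metric_space_axioms.intro)
  show ?thesis
    using decreasing_closed_property_if_stable_compact
      stable_seq_compact_if_decreasing_closed_property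
      stable_complete_if_stable_seq_compact stable_totally_bounded_if_stable_seq_compact
      stable_compact_if_stable_totally_bounded_stable_complete
    by blast
qed

end
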